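(* Let $n,t$ be positive integers with $n\geq 6$ and $3 \leq t \leq n- 3$, and let $T$ be a strongly $4\cdot 10^7$-connected tournament of order $n$ with a vertex $v\in V(T)$. Then there exist two vertex-disjoint directed cycles $C_1$ and $C_2$ in $T$ such that $v\in V(C_1)$, $|C_1|=t$ and $|C_2|=n-t$.
   Context: A tournament is a digraph (without loops) in which every pair of distinct vertices is joined by exactly one arc; its order is its number of vertices. $|C|$ denotes the number of vertices of a cycle $C$. A digraph is strongly connected if it has a directed path from $x$ to $y$ for every ordered pair of distinct vertices $x,y$; it is strongly $k$-connected if it has at least $k+1$ vertices and remains strongly connected whenever any set of at most $k-1$ vertices is deleted. *)

theory Defs
  imports "Graph_Theory.Digraph_Component"
begin

locale tournament = digraph +
  assumes ex1_arc:
    "\<lbrakk>u \<in> verts G; v \<in> verts G; u \<noteq> v\<rbrakk> \<Longrightarrow> \<exists>!e. e \<in> arcs G \<and> {tail G e, head G e} = {u, v}"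

text \<open>\<open>card S < k\<close> is ``at most \<open>k - 1\<close> vertices'' without truncated subtraction.\<close>

definition strongly_k_connected :: "nat \<Rightarrow> ('a, 'b) pre_digraph \<Rightarrow> bool" where
  "strongly_k_connected k G \<longleftrightarrow>
     k + 1 \<le> card (verts G) \<and>
     (\<forall>S. S \<subseteq> verts G \<and> finite S \<and> card S < k \<longrightarrow>
        strongly_connected (G \<restriction> (verts G - S)))"

text \<open>
  A cycle is represented, as in the predicate \<open>cycle\<close>, by its list of arcs. Since it is
  closed, each of its vertices is the tail of one of these arcs.
\<close>

definition (in pre_digraph) cycle_verts :: "'b awalk \<Rightarrow> 'a set" where
  "cycle_verts p = tail G ` set p"

lemma (in wf_digraph) cycle_verts_awalk:
  assumes "awalk u p u" "p \<noteq> []"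
  shows "cycle_verts p = set (awalk_verts u p)"
proof -
  have "tail G (hd p) = u" "head G (last p) = u"
    using assms awhd_if_cas[of u p u] awlast_if_cas[of u p u]
    by (auto simp: awalk_def awalk_verts_conv hd_append hd_map)
  moreover have "tail G (hd p) \<in> tail G ` set p"
    using assms(2) by simp
  ultimately show ?thesis
    using assms(2) by (auto simp: cycle_verts_def awalk_verts_conv)
qed

lemma (in wf_digraph) card_cycle_verts:
  assumes "cycle p"
  shows "card (cycle_verts p) = length p"
proof -
  from assms obtain u where u: "awalk u p u" "distinct (tl (awalk_verts u p))" "p \<noteq> []"
    by (auto simp: cycle_def)
  obtain xs where xs: "awalk_verts u p = u # xs"
    using u(1) awhd_if_cas[of u p u] by (cases "awalk_verts u p") (auto simp: awalk_def)
  have len: "length xs = length p"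
    using length_awalk_verts[of u p] xs by simp
  have "last (u # xs) = u"
    using u(1) awlast_if_cas[of u p u] xs by (simp add: awalk_def)
  then have "u \<in> set xs"
    using len u(3) by (metis last_ConsR last_in_set length_0_conv)
  then have "cycle_verts p = set xs"
    using cycle_verts_awalk[OF u(1,3)] xs by auto
  then show ?thesis
    using u(2) xs len by (simp add: distinct_card)
qed

end

theory Submission
  imports Defs
begin

text \<open>
  By Moon's theorem a strong tournament has, through each of its vertices, cycles of all lengths
  between 3 and its order. So it suffices to partition the vertices into two strong
  subtournaments of the prescribed orders, with \<open>v\<close> on the right side.

  The orders come for free once there is a set \<open>B\<close> with at most half of the vertices such that \<open>B\<close>
  and its complement are strong and every vertex outside \<open>B\<close>, except possibly \<open>v\<close>, has an in-neighbour
  and an out-neighbour in \<open>B\<close> (lemma \<open>robust_partition\<close>). Then every superset of \<open>B\<close> is strong, as long as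
  it does not contain this exception. So the smaller of the two cycles can be taken outside \<open>B\<close>, with any
  length, and the remaining vertices still form a strong tournament (lemma \<open>two_cycles\<close>).

  Such a \<open>B\<close> is built from two kinds of pieces.

  In any tournament at most four vertices suffice to dominate all but a few exceptional vertices, at most an eighth
  of the smallest in-degree (lemma \<open>fan_exists\<close>). With such a set, its dual, and a path from the dual
  to the set, strongness of a superset reduces to attaching the exceptional vertices individually (lemma
  \<open>strong_if_attached\<close>). For boundedly many vertices this is done by gadgets of four vertices (lemma
  \<open>gadgets\<close>).

  The path may be long, but it can be chosen as a shortest path. In a tournament all arcs between different
  layers of distance point backwards, except those between consecutive layers, and in a highly
  connected tournament all inner layers are large. Therefore removing a shortest path costs only four in
  connectivity (lemma \<open>kstrong_minus_geodesic\<close>), and a shortest path contains only a negligible part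
  of any neighbourhood (lemmas \<open>geodesic_few_in\<close> and \<open>geodesic_few_out\<close>).

  Consequently both \<open>B\<close> and its complement can be given such a structure (lemma \<open>cores_exist\<close>), and the
  remaining exceptional vertices have so many neighbours outside the structures that these
  neighbours can be distributed to both sides (lemma \<open>disjoint_hitting_sets\<close>).
\<close>

section \<open>Strong vertex sets of a digraph\<close>

text \<open>Arcs are given by a relation on vertices, and subdigraphs by vertex sets, since everything
  below is about induced subtournaments.\<close>

definition reach :: "('a \<Rightarrow> 'a \<Rightarrow> bool) \<Rightarrow> 'a set \<Rightarrow> 'a \<Rightarrow> 'a \<Rightarrow> bool" where
  "reach r X = (\<lambda>x y. x \<in> X \<and> y \<in> X \<and> r x y)\<^sup>*\<^sup>*"

definition strong :: "('a \<Rightarrow> 'a \<Rightarrow> bool) \<Rightarrow> 'a set \<Rightarrow> bool" where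
  "strong r X \<longleftrightarrow> (\<forall>x\<in>X. \<forall>y\<in>X. reach r X x y)"

lemma reach_refl [simp]: "reach r X x x"
  by (simp add: reach_def)

lemma reach_step: "x \<in> X \<Longrightarrow> y \<in> X \<Longrightarrow> r x y \<Longrightarrow> reach r X x y"
  by (auto simp: reach_def)

lemma reach_trans: "reach r X x y \<Longrightarrow> reach r X y z \<Longrightarrow> reach r X x z"
  by (auto simp: reach_def)

lemma reach_mono: "reach r X x y \<Longrightarrow> X \<subseteq> Y \<Longrightarrow> reach r Y x y"
  unfolding reach_def by (erule rtranclp_mono[THEN predicate2D, rotated]) auto

lemma reach_conversep: "reach r\<inverse>\<inverse> X x y \<longleftrightarrow> reach r X y x"
proof -
  have "(\<lambda>x y. x \<in> X \<and> y \<in> X \<and> r\<inverse>\<inverse> x y) = (\<lambda>x y. x \<in> X \<and> y \<in> X \<and> r x y)\<inverse>\<inverse>"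
    by (auto simp: fun_eq_iff)
  then show ?thesis by (simp add: reach_def rtranclp_conversep)
qed

lemma strong_conversep: "strong r\<inverse>\<inverse> X \<longleftrightarrow> strong r X"
  by (auto simp: strong_def reach_conversep)

lemma reach_closed:
  assumes "reach r X x y" "x \<in> S" "\<And>a b. a \<in> S \<Longrightarrow> b \<in> X \<Longrightarrow> r a b \<Longrightarrow> b \<in> S"
  shows "y \<in> S"
  using assms(1,2) unfolding reach_def by (induction rule: rtranclp_induct) (auto intro: assms(3))

text \<open>How strongness is exploited below: a set that no arc leaves and that contains a vertex of \<open>X\<close>
  contains all of \<open>X\<close>.\<close>

lemma strong_closed:
  assumes "strong r X" "x \<in> S" "x \<in> X" "\<And>a b. a \<in> S \<Longrightarrow> b \<in> X \<Longrightarrow> r a b \<Longrightarrow> b \<in> S"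
  shows "X \<subseteq> S"
  using assms reach_closed[of r X x _ S] unfolding strong_def by blast

lemma not_strong_cut:
  assumes "\<not> strong r X"
  obtains S where "S \<subseteq> X" "S \<noteq> {}" "S \<noteq> X" "\<And>a b. a \<in> S \<Longrightarrow> b \<in> X - S \<Longrightarrow> \<not> r a b"
proof -
  from assms obtain x y where xy: "x \<in> X" "y \<in> X" "\<not> reach r X x y"
    by (auto simp: strong_def)
  let ?S = "{a \<in> X. reach r X x a}"
  have "a \<in> ?S \<Longrightarrow> b \<in> X - ?S \<Longrightarrow> \<not> r a b" for a b
    using reach_step[of a X b r] reach_trans[of r X x a b] by auto
  moreover have "x \<in> ?S" "y \<notin> ?S" using xy by auto
  ultimately show thesis using that[of ?S] xy by blast
qed

section \<open>Strong tournaments are vertex pancyclic\<close>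

definition cycle_list :: "('a \<Rightarrow> 'a \<Rightarrow> bool) \<Rightarrow> 'a list \<Rightarrow> bool" where
  "cycle_list r xs \<longleftrightarrow> xs \<noteq> [] \<and> distinct xs \<and> successively r xs \<and> r (last xs) (hd xs)"

lemma cycle_list_rotate: "cycle_list r (xs @ ys) \<Longrightarrow> cycle_list r (ys @ xs)"
  by (cases "xs = []"; cases "ys = []") (auto simp: cycle_list_def successively_append_iff)

lemma cycle_list_snoc:
  "cycle_list r xs \<Longrightarrow> x \<notin> set xs \<Longrightarrow> r (last xs) x \<Longrightarrow> r x (hd xs) \<Longrightarrow> cycle_list r (xs @ [x])"
  by (auto simp: cycle_list_def successively_append_iff)

text \<open>The relational counterpart of a tournament. Reversing all arcs gives a tournament again, which
  halves the work below: facts about out-neighbours are the facts about in-neighbours of the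
  converse relation.\<close>

locale tournament_rel =
  fixes V :: "'a set" and r :: "'a \<Rightarrow> 'a \<Rightarrow> bool"
  assumes fin: "finite V"
    and arc_in: "r x y \<Longrightarrow> x \<in> V \<and> y \<in> V"
    and asym: "r x y \<Longrightarrow> \<not> r y x"
    and total: "x \<in> V \<Longrightarrow> y \<in> V \<Longrightarrow> x \<noteq> y \<Longrightarrow> r x y \<or> r y x"
begin

lemma irr: "\<not> r x x"
  using asym by blast

lemma tournament_rel_conversep: "tournament_rel V r\<inverse>\<inverse>"
  using fin arc_in asym total by unfold_locales auto

lemma finite_sub: "X \<subseteq> V \<Longrightarrow> finite X"
  using fin finite_subset by blast

lemma finite_in [simp]: "finite {y. r y x}" and finite_out [simp]: "finite {y. r x y}"
  using arc_in by (auto intro!: finite_subset[OF _ fin])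

text \<open>Walking along a path from an in-neighbour of \<open>x\<close> to an out-neighbour of \<open>x\<close>, one meets two
  consecutive vertices between which \<open>x\<close> fits.\<close>

lemma switch_point:
  assumes "r a x" "b \<in> set zs" "r x b" "set zs \<subseteq> V" "x \<notin> set zs"
  shows "\<exists>us c d ws. a # zs = us @ c # d # ws \<and> r c x \<and> r x d"
  using assms
proof (induction zs arbitrary: a)
  case (Cons d zs)
  show ?case
  proof (cases "r x d")
    case True
    then show ?thesis using Cons.prems(1) by (metis append_Nil)
  next
    case False
    then have "r d x" "b \<in> set zs" using Cons.prems total[of d x] arc_in[of a x] by auto
    with Cons.IH[of d] Cons.prems obtain us c e ws
      where "d # zs = us @ c # e # ws" "r c x" "r x e" by auto
    then show ?thesis by (metis append_Cons)
  qed
qed simp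

lemma cycle_list_insert:
  assumes "cycle_list r ys" "set ys \<subseteq> V" "x \<notin> set ys" "a \<in> set ys" "r a x" "b \<in> set ys" "r x b"
  obtains zs where "cycle_list r zs" "set zs = insert x (set ys)"
proof -
  obtain us ws where ys: "ys = us @ a # ws" using assms(4) by (meson split_list)
  have c: "cycle_list r (a # ws @ us)" using cycle_list_rotate[of r us "a # ws"] assms(1) ys by simp
  have "b \<in> set (ws @ us)" using assms(5,6,7) ys asym by auto
  then obtain us' c' d ws' where s: "a # ws @ us = us' @ c' # d # ws'" "r c' x" "r x d"
    using switch_point[of a x b "ws @ us"] assms ys by auto
  have "cycle_list r ((d # ws') @ (us' @ [c']))"
    using c s cycle_list_rotate[of r "us' @ [c']" "d # ws'"] by simp
  moreover have "set ((d # ws') @ (us' @ [c'])) = set ys"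
    using arg_cong[OF s(1), of set] ys by auto
  ultimately have "cycle_list r (((d # ws') @ (us' @ [c'])) @ [x])"
    using s assms(3) by (intro cycle_list_snoc) auto
  then show thesis using that \<open>set _ = set ys\<close> by fastforce
qed

lemma strong_has_arc:
  assumes "strong r X" "A \<subseteq> X" "A \<noteq> {}" "A \<noteq> X"
  obtains a b where "a \<in> A" "b \<in> X - A" "r a b"
  using strong_closed[of r X _ A] assms by blast

lemma strong_has_arc_into:
  assumes "strong r X" "A \<subseteq> X" "A \<noteq> {}" "A \<noteq> X"
  obtains a b where "a \<in> X - A" "b \<in> A" "r a b"
proof -
  have "X - A \<subseteq> X" "X - A \<noteq> {}" "X - A \<noteq> X" "X - (X - A) = A" using assms by auto
  then show thesis using strong_has_arc[OF assms(1), of "X - A"] that by metis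
qed

lemma strong_triangle:
  assumes "strong r X" "X \<subseteq> V" "v \<in> X" "3 \<le> card X"
  obtains ys where "cycle_list r ys" "length ys = 3" "v \<in> set ys" "set ys \<subseteq> X"
proof -
  have "{v} \<noteq> X" using assms(4) by auto
  let ?O = "{y \<in> X. r v y}"
  obtain o1 where o1: "o1 \<in> X" "r v o1"
    using strong_has_arc[of X "{v}"] assms \<open>{v} \<noteq> X\<close> by blast
  have "\<exists>a b. a \<in> ?O \<and> b \<in> X \<and> b \<noteq> v \<and> \<not> r v b \<and> r a b"
  proof (rule ccontr)
    assume n: "\<not> ?thesis"
    \<comment> \<open>then no arc leaves \<open>v\<close> together with its out-neighbours\<close>
    obtain i where i: "i \<in> X" "r i v"
      using strong_has_arc_into[of X "{v}"] assms \<open>{v} \<noteq> X\<close> by blast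
    show False
    proof (cases "insert v ?O = X")
      case True
      then have "i = v \<or> r v i" using i by auto
      then show ?thesis using i asym irr by metis
    next
      case False
      then obtain a b where "a \<in> insert v ?O" "b \<in> X - insert v ?O" "r a b"
        using strong_has_arc[OF assms(1), of "insert v ?O"] assms(3) by blast
      then show ?thesis using n by auto
    qed
  qed
  then obtain a b where ab: "a \<in> X" "r v a" "b \<in> X" "b \<noteq> v" "\<not> r v b" "r a b" by auto
  then have "r b v" using total[of b v] assms by blast
  then have "cycle_list r [v, a, b]" using ab irr by (auto simp: cycle_list_def)
  then show thesis using that[of "[v, a, b]"] ab assms by auto
qed

text \<open>If no outside vertex can be inserted into the cycle, then each of them dominates or is
  dominated by the whole cycle. By strongness there is an arc from a dominated vertex \<open>c\<close> to a
  dominating vertex \<open>i\<close>, and the path \<open>c, i\<close> can replace any single vertex of the cycle, in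
  particular one other than \<open>v\<close>.\<close>

lemma cycle_list_extend:
  assumes "strong r X" "X \<subseteq> V" "cycle_list r ys" "set ys \<subseteq> X" "set ys \<noteq> X" "v \<in> set ys" "3 \<le> length ys"
  obtains zs where "cycle_list r zs" "length zs = Suc (length ys)" "v \<in> set zs" "set zs \<subseteq> X"
proof -
  note thesisI = that
  have lenI: thesis if "cycle_list r zs" "card (set zs) = Suc (length ys)" "v \<in> set zs" "set zs \<subseteq> X" for zs
    using thesisI[of zs] that by (simp add: cycle_list_def distinct_card)
  have dys: "distinct ys" "ys \<noteq> []" using assms(3) by (auto simp: cycle_list_def)
  show thesis
  proof (cases "\<exists>x\<in>X - set ys. (\<exists>a\<in>set ys. r a x) \<and> (\<exists>b\<in>set ys. r x b)")
    case True
    then obtain x a b where x: "x \<in> X" "x \<notin> set ys" "a \<in> set ys" "r a x" "b \<in> set ys" "r x b" by blast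
    obtain zs where "cycle_list r zs" "set zs = insert x (set ys)"
      using cycle_list_insert[OF assms(3) _ x(2-6)] assms by blast
    then show ?thesis using lenI[of zs] x assms dys by (simp add: distinct_card)
  next
    case False
    let ?O = "{x \<in> X - set ys. \<forall>a\<in>set ys. r a x}"
    have dich: "x \<in> ?O \<or> (\<forall>a\<in>set ys. r x a)" if "x \<in> X - set ys" for x
    proof (rule disjCI)
      assume "\<not> (\<forall>a\<in>set ys. r x a)"
      then obtain a where "a \<in> set ys" "\<not> r x a" by blast
      then have "r a x" using total[of x a] that assms(2,4) by blast
      then have "\<forall>b\<in>set ys. \<not> r x b" using False that \<open>a \<in> set ys\<close> by blast
      then show "x \<in> ?O" using total[of x] that assms(2,4) by blast
    qed
    obtain a o1 where o1: "a \<in> set ys" "o1 \<in> X - set ys" "r a o1"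
      using strong_has_arc[OF assms(1,4) _ assms(5)] dys(2) by (metis set_empty)
    have ne: "set ys \<union> ?O \<noteq> X"
    proof
      assume "set ys \<union> ?O = X"
      moreover obtain c d where "c \<in> X - set ys" "d \<in> set ys" "r c d"
        using strong_has_arc_into[OF assms(1,4) _ assms(5)] dys(2) by (metis set_empty)
      ultimately show False using asym by auto
    qed
    have "set ys \<union> ?O \<subseteq> X" "set ys \<union> ?O \<noteq> {}" using assms dys by auto
    from this ne obtain c i where ci: "c \<in> set ys \<union> ?O" "i \<in> X - (set ys \<union> ?O)" "r c i"
      by (rule strong_has_arc[OF assms(1), of "set ys \<union> ?O"])
    have i: "\<forall>a\<in>set ys. r i a" "i \<in> X" "i \<notin> set ys" using dich ci by auto
    then have "c \<in> ?O" using ci asym by blast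
    have "card (set ys - {v}) > 0" using dys assms(6,7) by (simp add: distinct_card)
    then obtain a where "a \<in> set ys" "a \<noteq> v" by (auto simp: card_gt_0_iff)
    then obtain us ws where ys: "ys = us @ a # ws" by (meson split_list)
    define l where "l = ws @ us"
    have al: "cycle_list r (a # l)" "set ys = insert a (set l)" "length ys = Suc (length l)"
      using cycle_list_rotate[of r us "a # ws"] assms(3) ys by (auto simp: l_def)
    then have l: "l \<noteq> []" using assms(7) by auto
    have "c \<noteq> i" using ci irr by blast
    then have "cycle_list r (l @ [c, i])"
      using al l \<open>c \<in> ?O\<close> i ci by (auto simp: cycle_list_def successively_append_iff successively_Cons)
    then show ?thesis using thesisI[of "l @ [c, i]"] al i \<open>c \<in> ?O\<close> \<open>a \<noteq> v\<close> assms by auto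
  qed
qed

text \<open>This is Moon's theorem: a triangle through \<open>v\<close> grows by one vertex at a time.\<close>

theorem vertex_pancyclic:
  assumes "strong r X" "X \<subseteq> V" "v \<in> X" "3 \<le> t" "t \<le> card X"
  obtains ys where "cycle_list r ys" "length ys = t" "v \<in> set ys" "set ys \<subseteq> X"
proof -
  have "\<exists>ys. cycle_list r ys \<and> length ys = t \<and> v \<in> set ys \<and> set ys \<subseteq> X" using assms(4,5)
  proof (induction t rule: dec_induct)
    case base
    show ?case by (rule strong_triangle[OF assms(1-3)]) (use assms(4,5) in auto)
  next
    case (step t)
    then obtain ys where ys: "cycle_list r ys" "length ys = t" "v \<in> set ys" "set ys \<subseteq> X" by auto
    then have "card (set ys) = t" by (auto simp: cycle_list_def distinct_card)
    then have "set ys \<noteq> X" using step by auto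
    show ?case
      by (rule cycle_list_extend[OF assms(1,2) ys(1,4) _ ys(3)]) (use ys(2) step.hyps \<open>set ys \<noteq> X\<close> in auto)
  qed
  then show thesis using that by blast
qed

end

section \<open>Shortest paths in highly connected tournaments\<close>

definition kstrong :: "('a \<Rightarrow> 'a \<Rightarrow> bool) \<Rightarrow> 'a set \<Rightarrow> nat \<Rightarrow> bool" where
  "kstrong r H k \<longleftrightarrow> (\<forall>S\<subseteq>H. card S < k \<longrightarrow> strong r (H - S))"

lemma kstrong_Diff:
  assumes "kstrong r H k" "finite H" "S \<subseteq> H" "card S \<le> j"
  shows "kstrong r (H - S) (k - j)"
  unfolding kstrong_def
proof (intro allI impI)
  fix S' assume S': "S' \<subseteq> H - S" "card S' < k - j"
  have "card (S \<union> S') \<le> card S + card S'" by (rule card_Un_le)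
  then have "card (S \<union> S') < k" using S' assms(4) by linarith
  moreover have "S \<union> S' \<subseteq> H" using S' assms(3) by blast
  ultimately have "strong r (H - (S \<union> S'))" using assms(1) by (auto simp: kstrong_def)
  then show "strong r (H - S - S')" by (simp add: Diff_Diff_Int set_diff_eq Un_def conj_assoc)
qed

lemma kstrong_strong: "kstrong r H k \<Longrightarrow> 0 < k \<Longrightarrow> strong r H"
  unfolding kstrong_def by (metis Diff_empty card.empty empty_subsetI)

text \<open>A path \<open>p 0, \<dots>, p l\<close> in \<open>H\<close> together with a potential \<open>f\<close> that grows by at most one along each arc and
  is \<open>i\<close> at \<open>p i\<close>. The potential certifies that the path is shortest; for the paths constructed here it
  is the distance from \<open>p 0\<close>. Its level sets are the layers of \<open>H\<close>.\<close>

definition geodesic :: "('a \<Rightarrow> 'a \<Rightarrow> bool) \<Rightarrow> 'a set \<Rightarrow> (nat \<Rightarrow> 'a) \<Rightarrow> nat \<Rightarrow> ('a \<Rightarrow> nat) \<Rightarrow> bool" where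
  "geodesic r H p l f \<longleftrightarrow>
     (\<forall>i\<le>l. p i \<in> H \<and> f (p i) = i) \<and> (\<forall>i<l. r (p i) (p (Suc i))) \<and>
     (\<forall>x\<in>H. \<forall>y\<in>H. r x y \<longrightarrow> f y \<le> Suc (f x))"

lemma geodesic_exists:
  assumes "strong r H" "z \<in> H" "w \<in> H"
  shows "\<exists>p l f. geodesic r H p l f \<and> p 0 = z \<and> p l = w"
proof -
  define R where "R = {(x, y). x \<in> H \<and> y \<in> H \<and> r x y}"
  define f where "f x = (LEAST n. (z, x) \<in> R ^^ n)" for x
  have Rst: "(z, x) \<in> R\<^sup>*" if "x \<in> H" for x
    using assms that
    by (auto simp: strong_def reach_def R_def Enum.rtranclp_rtrancl_eq)
  have f1: "(z, x) \<in> R ^^ f x" if "x \<in> H" for x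
    unfolding f_def by (rule LeastI_ex) (use Rst[OF that] in \<open>auto dest: rtrancl_imp_relpow\<close>)
  have f2: "f x \<le> n" if "(z, x) \<in> R ^^ n" for x n
    unfolding f_def using that by (rule Least_le)
  have lip: "f y \<le> Suc (f x)" if "x \<in> H" "y \<in> H" "r x y" for x y
    using f2[of y "Suc (f x)"] f1[OF that(1)] that by (auto simp: R_def)
  define l where "l = f w"
  from f1[OF assms(3)] obtain p where p: "p 0 = z" "p l = w" "\<forall>i<l. (p i, p (Suc i)) \<in> R"
    unfolding relpow_fun_conv l_def by blast
  have pH: "p i \<in> H" if "i \<le> l" for i
    using p that assms(2) by (cases i) (auto simp: R_def)
  have up: "f (p i) \<le> i" if "i \<le> l" for i
    by (rule f2) (use p that in \<open>auto simp: relpow_fun_conv intro!: exI[of _ p]\<close>)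
  have fp: "f (p (i + j)) \<le> f (p i) + j" if "i + j \<le> l" for i j
    using that
  proof (induction j)
    case (Suc j)
    then have "f (p (Suc (i + j))) \<le> Suc (f (p (i + j)))"
      using p(3) by (intro lip pH) (auto simp: R_def)
    then show ?case using Suc by simp
  qed simp
  have "i \<le> f (p i)" if "i \<le> l" for i
    using fp[of i "l - i"] that p(2) l_def by simp
  then have "geodesic r H p l f"
    unfolding geodesic_def using up pH lip p(3) by (auto simp: R_def le_antisym)
  then show ?thesis using p by blast
qed

lemma geodesicD:
  assumes "geodesic r H p l f"
  shows "\<And>i. i \<le> l \<Longrightarrow> p i \<in> H" "\<And>i. i \<le> l \<Longrightarrow> f (p i) = i" "\<And>i. i < l \<Longrightarrow> r (p i) (p (Suc i))"
    "\<And>x y. x \<in> H \<Longrightarrow> y \<in> H \<Longrightarrow> r x y \<Longrightarrow> f y \<le> Suc (f x)"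
  using assms by (auto simp: geodesic_def)

lemma geodesic_reach:
  assumes "geodesic r H p l f" "p ` {..l} \<subseteq> X" "i \<le> j" "j \<le> l"
  shows "reach r X (p i) (p j)"
  using assms(3,4)
proof (induction j rule: dec_induct)
  case (step j)
  then have "reach r X (p j) (p (Suc j))"
    using assms(2) geodesicD(3)[OF assms(1), of j] by (intro reach_step) auto
  then show ?case using step reach_trans by fastforce
qed simp

context tournament_rel
begin

text \<open>No arc jumps forward over a layer, so in a tournament all arcs between layers that are not
  consecutive point backwards.\<close>

lemma geodesic_back:
  assumes "geodesic r H p l f" "H \<subseteq> V" "x \<in> H" "y \<in> H" "f y + 2 \<le> f x"
  shows "r x y"
proof -
  have "\<not> r y x" using geodesicD(4)[OF assms(1), of y x] assms by auto
  moreover have "x \<noteq> y" using assms by auto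
  ultimately show ?thesis using total[of x y] assms by auto
qed

text \<open>An inner layer separates the end of the path from its start, so it is at least as large as the
  connectivity.\<close>

lemma layer_card:
  assumes "geodesic r H p l f" "kstrong r H k" "0 < i" "i < l"
  shows "k \<le> card {y \<in> H. f y = i}"
proof (rule ccontr)
  let ?L = "{y \<in> H. f y = i}"
  assume "\<not> k \<le> card ?L"
  then have st: "strong r (H - ?L)" using assms(2) by (auto simp: kstrong_def)
  have "H - ?L \<subseteq> {y \<in> H. f y < i}"
  proof (rule strong_closed[OF st, of "p 0"])
    show "p 0 \<in> {y \<in> H. f y < i}" "p 0 \<in> H - ?L" using geodesicD(1,2)[OF assms(1), of 0] assms by auto
    fix a b assume "a \<in> {y \<in> H. f y < i}" "b \<in> H - ?L" "r a b"
    then show "b \<in> {y \<in> H. f y < i}" using geodesicD(4)[OF assms(1), of a b] by auto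
  qed
  moreover have "p l \<in> H - ?L" using geodesicD(1,2)[OF assms(1), of l] assms by auto
  ultimately show False using geodesicD(2)[OF assms(1), of l] assms(4) by auto
qed

lemma layers_card:
  assumes "geodesic r H p l f" "kstrong r H k" "finite H" "J \<subseteq> {0<..<l}"
  shows "k * card J \<le> card {y \<in> H. f y \<in> J}"
proof -
  have fJ: "finite J" using assms(4) finite_subset by blast
  have "k * card J = (\<Sum>i\<in>J. k)" by simp
  also have "\<dots> \<le> (\<Sum>i\<in>J. card {y \<in> H. f y = i})"
    using layer_card[OF assms(1,2)] assms(4) by (intro sum_mono) auto
  also have "\<dots> = card (\<Union>i\<in>J. {y \<in> H. f y = i})"
    using fJ assms(3) by (intro card_UN_disjoint[symmetric]) auto
  also have "(\<Union>i\<in>J. {y \<in> H. f y = i}) = {y \<in> H. f y \<in> J}" by auto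
  finally show ?thesis .
qed

lemma geodesic_length:
  assumes "geodesic r H p l f" "kstrong r H k" "finite H"
  shows "k * (card (p ` {..l}) - 2) \<le> card H"
proof -
  have "card (p ` {..l}) \<le> Suc l" using card_image_le[of "{..l}" p] by simp
  then have "card (p ` {..l}) - 2 \<le> card {0<..<l}" unfolding card_greaterThanLessThan by arith
  then have "k * (card (p ` {..l}) - 2) \<le> k * card {0<..<l}" by (rule mult_le_mono2)
  also have "\<dots> \<le> card {y \<in> H. f y \<in> {0<..<l}}" by (rule layers_card[OF assms]) simp
  also have "\<dots> \<le> card H" using assms(3) by (intro card_mono) auto
  finally show ?thesis .
qed

text \<open>A shortest path is sparse in every neighbourhood \<open>N\<close> of a vertex \<open>x\<close>: with up to five exceptions
  (index set \<open>A\<close>), each path vertex in \<open>N\<close> comes with its whole layer (index set \<open>J\<close>). For in-neighbours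
  the reason is that all vertices two or more layers above \<open>x\<close> dominate \<open>x\<close>, for out-neighbours that \<open>x\<close>
  dominates all vertices two or more layers below.\<close>

lemma geodesic_sparse:
  assumes "geodesic r H p l f" "kstrong r H k" "H \<subseteq> V" "N \<subseteq> V"
    and "J \<subseteq> {0<..<l}" "card A \<le> 5" "finite A"
    and "\<And>i. i \<le> l \<Longrightarrow> p i \<in> N \<Longrightarrow> i \<in> A \<union> J" "{y \<in> H. f y \<in> J} \<subseteq> N"
  shows "k * (card (N \<inter> p ` {..l}) - 5) \<le> card N"
proof -
  have fJ: "finite J" using assms(5) finite_subset by blast
  have "N \<inter> p ` {..l} \<subseteq> p ` (A \<union> J)" using assms(8) by blast
  then have "card (N \<inter> p ` {..l}) \<le> card (p ` (A \<union> J))" using fJ assms(7) by (intro card_mono) auto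
  also have "\<dots> \<le> card (A \<union> J)" using fJ assms(7) by (intro card_image_le) auto
  also have "\<dots> \<le> card A + card J" by (rule card_Un_le)
  finally have "card (N \<inter> p ` {..l}) - 5 \<le> card J" using assms(6) by linarith
  then have "k * (card (N \<inter> p ` {..l}) - 5) \<le> k * card J" by (rule mult_le_mono2)
  also have "\<dots> \<le> card {y \<in> H. f y \<in> J}"
    by (rule layers_card[OF assms(1,2) finite_sub[OF assms(3)] assms(5)])
  also have "\<dots> \<le> card N" by (rule card_mono[OF finite_sub[OF assms(4)] assms(9)])
  finally show ?thesis .
qed

lemma geodesic_few_in:
  assumes "geodesic r H p l f" "kstrong r H k" "H \<subseteq> V" "x \<in> H"
  shows "k * (card ({y. r y x} \<inter> p ` {..l}) - 5) \<le> card {y. r y x}"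
proof (rule geodesic_sparse[OF assms(1-3), where J = "{i. 0 < i \<and> i < l \<and> f x + 2 \<le> i}"
      and A = "{f x - 1, f x, f x + 1, 0, l}"])
  show "card {f x - 1, f x, f x + 1, 0, l} \<le> 5"
    using card_length[of "[f x - 1, f x, f x + 1, 0, l]"] by simp
  fix i assume i: "i \<le> l" "p i \<in> {y. r y x}"
  then have "f x \<le> Suc i"
    using geodesicD(4)[OF assms(1), of "p i" x] geodesicD(1,2)[OF assms(1), of i] assms(4) by auto
  then show "i \<in> {f x - 1, f x, f x + 1, 0, l} \<union> {i. 0 < i \<and> i < l \<and> f x + 2 \<le> i}" using i by auto
qed (use arc_in geodesic_back[OF assms(1,3) _ assms(4)] in auto)

lemma geodesic_few_out:
  assumes "geodesic r H p l f" "kstrong r H k" "H \<subseteq> V" "x \<in> H"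
  shows "k * (card ({y. r x y} \<inter> p ` {..l}) - 5) \<le> card {y. r x y}"
proof (rule geodesic_sparse[OF assms(1-3), where J = "{i. 0 < i \<and> i < l \<and> i + 2 \<le> f x}"
      and A = "{f x - 1, f x, f x + 1, 0, l}"])
  show "card {f x - 1, f x, f x + 1, 0, l} \<le> 5"
    using card_length[of "[f x - 1, f x, f x + 1, 0, l]"] by simp
  fix i assume i: "i \<le> l" "p i \<in> {y. r x y}"
  then have "i \<le> Suc (f x)"
    using geodesicD(4)[OF assms(1), of x "p i"] geodesicD(1,2)[OF assms(1), of i] assms(4) by auto
  then show "i \<in> {f x - 1, f x, f x + 1, 0, l} \<union> {i. 0 < i \<and> i < l \<and> i + 2 \<le> f x}" using i by auto
qed (use arc_in geodesic_back[OF assms(1,3,4)] in auto)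

text \<open>The out-neighbours of the start lie in layers \<open>0\<close> and \<open>1\<close>, and the in-neighbours of the end in or
  above the layer before the last one. So the path uses at most two of either, whatever their number.\<close>

lemma geodesic_start_out:
  assumes "geodesic r H p l f"
  shows "card ({u. r (p 0) u} \<inter> p ` {..l}) \<le> 2"
proof -
  have "{u. r (p 0) u} \<inter> p ` {..l} \<subseteq> {p 0, p 1}"
  proof
    fix u assume "u \<in> {u. r (p 0) u} \<inter> p ` {..l}"
    then obtain j where j: "j \<le> l" "u = p j" "r (p 0) (p j)" by auto
    have "j \<le> 1"
      using geodesicD(4)[OF assms, of "p 0" "p j"] geodesicD(1,2)[OF assms, of 0]
        geodesicD(1,2)[OF assms, of j] j by auto
    then have "j = 0 \<or> j = 1" by arith
    then show "u \<in> {p 0, p 1}" using j by auto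
  qed
  then have "card ({u. r (p 0) u} \<inter> p ` {..l}) \<le> card {p 0, p 1}" by (intro card_mono) auto
  then show ?thesis using card_length[of "[p 0, p 1]"] by simp
qed

lemma geodesic_end_in:
  assumes "geodesic r H p l f"
  shows "card ({u. r u (p l)} \<inter> p ` {..l}) \<le> 2"
proof -
  have "{u. r u (p l)} \<inter> p ` {..l} \<subseteq> {p (l - 1), p l}"
  proof
    fix u assume "u \<in> {u. r u (p l)} \<inter> p ` {..l}"
    then obtain j where j: "j \<le> l" "u = p j" "r (p j) (p l)" by auto
    have "l \<le> Suc j"
      using geodesicD(4)[OF assms, of "p j" "p l"] geodesicD(1,2)[OF assms, of l]
        geodesicD(1,2)[OF assms, of j] j by auto
    then have "j = l - 1 \<or> j = l" using j(1) by arith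
    then show "u \<in> {p (l - 1), p l}" using j by auto
  qed
  then have "card ({u. r u (p l)} \<inter> p ` {..l}) \<le> card {p (l - 1), p l}" by (intro card_mono) auto
  then show ?thesis using card_length[of "[p (l - 1), p l]"] by simp
qed

text \<open>A shortest path can be removed at the cost of at most four in connectivity. Suppose that removing
  the path and \<open>S\<close> leaves a cut with no arc from \<open>X\<close> to \<open>Y\<close>; then all arcs between them go from \<open>Y\<close> to
  \<open>X\<close>. Let \<open>M\<close> be the largest index at which an arc from \<open>X\<close> enters the path. Since the potential grows by at
  most one per arc, no arc into \<open>Y\<close> leaves the path before index \<open>M - 3\<close>. As the path moves forward
  only in single steps, the four path vertices with indices \<open>M - 3, \<dots>, M\<close> block every route from \<open>X\<close>
  to \<open>Y\<close> through the path.\<close>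

lemma kstrong_minus_geodesic:
  assumes "geodesic r H p l f" "kstrong r H k" "H \<subseteq> V"
  shows "kstrong r (H - p ` {..l}) (k - 4)"
  unfolding kstrong_def
proof (intro allI impI)
  let ?P = "p ` {..l}"
  fix S assume S: "S \<subseteq> H - ?P" "card S < k - 4"
  note g = geodesicD[OF assms(1)]
  show "strong r (H - ?P - S)"
  proof (rule ccontr)
    assume "\<not> strong r (H - ?P - S)"
    from not_strong_cut[OF this] obtain X where X: "X \<subseteq> H - ?P - S" "X \<noteq> {}" "X \<noteq> H - ?P - S"
      and noarc: "\<And>a b. a \<in> X \<Longrightarrow> b \<in> (H - ?P - S) - X \<Longrightarrow> \<not> r a b" by metis
    define Y where "Y = (H - ?P - S) - X"
    obtain y where y: "y \<in> Y" using X by (auto simp: Y_def)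
    obtain x where x: "x \<in> X" using X by blast
    have YX: "r b a" if "a \<in> X" "b \<in> Y" for a b
      using that noarc[of a b] total[of a b] X assms(3) by (auto simp: Y_def)
    define M where "M = Max (insert 0 {i. i \<le> l \<and> (\<exists>a\<in>X. r a (p i))})"
    have fM: "finite (insert 0 {i. i \<le> l \<and> (\<exists>a\<in>X. r a (p i))})" by simp
    have M1: "i \<le> M" if "i \<le> l" "a \<in> X" "r a (p i)" for i a
      unfolding M_def using that fM by (intro Max_ge) auto
    have M2: "M = 0 \<or> (\<exists>a\<in>X. r a (p M) \<and> M \<le> l)"
      using Max_in[OF fM] by (auto simp: M_def[symmetric])
    have late: "M \<le> j + 3" if j: "j \<le> l" "b \<in> Y" "r (p j) b" for j b
    proof (cases "M = 0")
      case False
      then obtain a where a: "a \<in> X" "r a (p M)" "M \<le> l" using M2 by blast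
      have "f b \<le> Suc j" "f a \<le> Suc (f b)" "M \<le> Suc (f a)"
        using g(4)[of "p j" b] g(4)[of b a] g(4)[of a "p M"] g(1,2) j a YX[of a b] X
        by (auto simp: Y_def)
      then show ?thesis by simp
    qed simp
    define Q where "Q = p ` ({M - 3..M} \<inter> {..l})"
    have "card Q \<le> card ({M - 3..M} \<inter> {..l})" unfolding Q_def by (rule card_image_le) simp
    also have "\<dots> \<le> card {M - 3..M}" by (rule card_mono) auto
    finally have "card Q \<le> 4" by simp
    then have "card (S \<union> Q) < k" using S(2) card_Un_le[of S Q] by linarith
    moreover have "S \<union> Q \<subseteq> H" using S(1) g(1) by (auto simp: Q_def)
    ultimately have st: "strong r (H - (S \<union> Q))" using assms(2) by (simp add: kstrong_def)
    have "H - (S \<union> Q) \<subseteq> X \<union> p ` {i. i \<le> l \<and> i + 3 < M}"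
    proof (rule strong_closed[OF st, of x])
      show "x \<in> X \<union> p ` {i. i \<le> l \<and> i + 3 < M}" "x \<in> H - (S \<union> Q)"
        using x X by (auto simp: Q_def)
      fix a b assume a: "a \<in> X \<union> p ` {i. i \<le> l \<and> i + 3 < M}" and b: "b \<in> H - (S \<union> Q)" and ab: "r a b"
      have bc: "b \<in> X \<or> b \<in> Y \<or> (\<exists>j. j \<le> l \<and> b = p j \<and> (j + 3 < M \<or> M < j))"
        using b by (fastforce simp: Y_def Q_def)
      show "b \<in> X \<union> p ` {i. i \<le> l \<and> i + 3 < M}"
      proof (cases "a \<in> X")
        case True
        then show ?thesis using bc noarc[of a b] ab M1[of _ a] by (fastforce simp: Y_def)
      next
        case False
        then obtain i where i: "i \<le> l" "a = p i" "i + 3 < M" using a by auto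
        then have "b \<notin> Y" using late[of i b] ab by auto
        moreover have "j \<le> Suc i" if "j \<le> l" "b = p j" for j
          using g(4)[of a b] g(1,2)[of i] g(1,2)[of j] i that ab by auto
        ultimately show ?thesis using bc i by fastforce
      qed
    qed
    moreover have "y \<in> H - (S \<union> Q)" "y \<notin> X" "y \<notin> ?P" using y by (auto simp: Y_def Q_def)
    ultimately show False by auto
  qed
qed

end

section \<open>Small sets that dominate almost everything\<close>

definition cover :: "('a \<Rightarrow> 'a \<Rightarrow> bool) \<Rightarrow> 'a set \<Rightarrow> 'a set" where
  "cover r D = D \<union> {y. \<exists>d\<in>D. r d y}"

text \<open>The last condition makes sure that every vertex of \<open>U\<close>, whether covered or not, has plenty of covered
  in-neighbours, provided that few of its in-neighbours lie outside \<open>U\<close>. The set \<open>U\<close> excludes vertices that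
  are reserved for other purposes; in-degrees still count all vertices.\<close>

definition fan :: "('a \<Rightarrow> 'a \<Rightarrow> bool) \<Rightarrow> 'a set \<Rightarrow> 'a set \<Rightarrow> 'a \<Rightarrow> bool" where
  "fan r U D w \<longleftrightarrow> D \<subseteq> U \<and> w \<in> D \<and> card D \<le> 4 \<and> (\<forall>y\<in>D. y = w \<or> r w y) \<and>
     (\<forall>x\<in>U. 8 * card (U - cover r D) \<le> card {y. r y x})"

context tournament_rel
begin

lemma low_indegree_vertex:
  assumes "E \<subseteq> V" "E \<noteq> {}"
  shows "\<exists>x\<in>E. 2 * card {e \<in> E. r e x} \<le> card E"
proof (rule ccontr)
  assume "\<not> ?thesis"
  then have low: "card E < 2 * card {e \<in> E. r e x}" if "x \<in> E" for x using that by auto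
  have fE: "finite E" using assms finite_sub by blast
  have "card {e \<in> E. r x e} < card {e \<in> E. r e x}" if x: "x \<in> E" for x
  proof -
    have "{e \<in> E. r x e} \<inter> {e \<in> E. r e x} = {}" using asym by auto
    then have "card {e \<in> E. r x e} + card {e \<in> E. r e x} = card ({e \<in> E. r x e} \<union> {e \<in> E. r e x})"
      using fE by (simp add: card_Un_disjoint)
    also have "\<dots> \<le> card E" using fE by (intro card_mono) auto
    finally show ?thesis using low[OF x] by simp
  qed
  then have "(\<Sum>x\<in>E. card {e \<in> E. r x e}) < (\<Sum>x\<in>E. card {e \<in> E. r e x})"
    using assms(2) fE by (intro sum_strict_mono) auto
  moreover have "(\<Sum>x\<in>E. card {e \<in> E. r x e}) = (\<Sum>x\<in>E. card {e \<in> E. r e x})"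
    using sum.swap[of "\<lambda>x e. if r x e then 1 else 0::nat" E E] fE
    by (simp add: sum.If_cases card_eq_sum[symmetric] Int_def)
  ultimately show False by simp
qed

text \<open>Start with \<open>u\<close> and repeatedly add, among the vertices that are not yet covered, one that covers
  at least half of them. It was uncovered, so it dominates all vertices chosen before.\<close>

lemma dominating_chain:
  assumes "U \<subseteq> V" "u \<in> U"
  shows "\<exists>D w. D \<subseteq> U \<and> w \<in> D \<and> card D \<le> Suc j \<and> (\<forall>y\<in>D. y = w \<or> r w y) \<and>
           2 ^ j * card (U - cover r D) \<le> card {y. r y u}"
proof (induction j)
  case 0
  have "U - cover r {u} \<subseteq> {y. r y u}" using assms total[of _ u] by (auto simp: cover_def)
  then have "card (U - cover r {u}) \<le> card {y. r y u}" by (rule card_mono[rotated]) simp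
  then show ?case using assms(2) by (intro exI[of _ "{u}"] exI[of _ u]) auto
next
  case (Suc j)
  then obtain D w where D: "D \<subseteq> U" "w \<in> D" "card D \<le> Suc j" "\<forall>y\<in>D. y = w \<or> r w y"
    and bd: "2 ^ j * card (U - cover r D) \<le> card {y. r y u}" by blast
  let ?E = "U - cover r D"
  show ?case
  proof (cases "?E = {}")
    case True
    have "card ?E = 0" unfolding True by simp
    then show ?thesis using D by (intro exI[of _ D] exI[of _ w]) auto
  next
    case False
    obtain x where x: "x \<in> ?E" "2 * card {e \<in> ?E. r e x} \<le> card ?E"
      using low_indegree_vertex[of ?E] False assms by auto
    have xD: "r x d" if "d \<in> D" for d
      using that x total[of x d] D(1) assms(1) by (auto simp: cover_def)
    have fE: "finite {e \<in> ?E. r e x}" using finite_sub assms by (simp add: finite_subset)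
    have "U - cover r (insert x D) \<subseteq> {e \<in> ?E. r e x}"
      using x total[of x] assms(1) by (auto simp: cover_def)
    from card_mono[OF fE this] have "2 * card (U - cover r (insert x D)) \<le> card ?E" using x(2) by linarith
    then have "2 ^ j * (2 * card (U - cover r (insert x D))) \<le> 2 ^ j * card ?E" by (rule mult_le_mono2)
    then have "2 ^ Suc j * card (U - cover r (insert x D)) \<le> card {y. r y u}"
      using bd by (simp only: power_Suc2 mult.assoc)
    moreover have "card (insert x D) \<le> Suc (Suc j)"
      using D(3) card_insert_le_m1[of "Suc (Suc j)" D x] by simp
    ultimately show ?thesis using x D(1) xD by (intro exI[of _ "insert x D"] exI[of _ x]) auto
  qed
qed

text \<open>Three steps from a vertex of smallest in-degree.\<close>

lemma fan_exists:
  assumes "U \<subseteq> V" "U \<noteq> {}"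
  shows "\<exists>D w. fan r U D w"
proof -
  obtain u where u: "u \<in> U" "\<forall>x\<in>U. card {y. r y u} \<le> card {y. r y x}"
    using ex_is_arg_min_if_finite[OF finite_sub[OF assms(1)] assms(2), of "\<lambda>x. card {y. r y x}"]
    by (auto simp: is_arg_min_linorder)
  obtain D w where "D \<subseteq> U" "w \<in> D" "card D \<le> Suc 3" "\<forall>y\<in>D. y = w \<or> r w y"
    "2 ^ 3 * card (U - cover r D) \<le> card {y. r y u}"
    using dominating_chain[OF assms(1) u(1), of 3] by blast
  then have "fan r U D w" using u(2) by (fastforce simp: fan_def)
  then show ?thesis by blast
qed

end

section \<open>Disjoint hitting sets\<close>

lemma hitting_set:
  assumes "finite F" "finite A" "\<And>S. S \<in> F \<Longrightarrow> card A < card S"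
  obtains W where "W \<subseteq> \<Union>F" "W \<inter> A = {}" "card W \<le> card F" "finite W" "\<And>S. S \<in> F \<Longrightarrow> S \<inter> W \<noteq> {}"
proof -
  have "\<exists>x. x \<in> S - A" if "S \<in> F" for S
    using assms(3)[OF that] card_mono[OF assms(2), of S] by fastforce
  then obtain h where h: "\<And>S. S \<in> F \<Longrightarrow> h S \<in> S - A" by metis
  show thesis
    by (rule that[of "h ` F"]) (use h assms(1) in \<open>auto intro: card_image_le\<close>)
qed

lemma disjoint_hitting_sets_aux:
  assumes fin: "finite A1" "finite B1" "finite A2" "finite B2"
    and big: "\<And>S. S \<in> A1 \<union> B1 \<Longrightarrow> 2 * (card A1 + card B1) < card S"
      "\<And>S. S \<in> A2 \<union> B2 \<Longrightarrow> 2 * (card A2 + card B2) < card S"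
    and le: "card A1 + card B1 \<le> card A2 + card B2"
  shows "\<exists>X Y. X \<inter> Y = {} \<and> X \<subseteq> \<Union>(A1 \<union> A2) \<and> Y \<subseteq> \<Union>(B1 \<union> B2) \<and> card Y \<le> card B1 + card B2 \<and>
           (\<forall>S\<in>A1 \<union> A2. S \<inter> X \<noteq> {}) \<and> (\<forall>S\<in>B1 \<union> B2. S \<inter> Y \<noteq> {})"
proof -
  have 1: "card {} < card S" if "S \<in> A1" for S :: "'a set" using big(1)[of S] that by simp
  obtain X1 where X1: "X1 \<subseteq> \<Union>A1" "card X1 \<le> card A1" "finite X1" "\<And>S. S \<in> A1 \<Longrightarrow> S \<inter> X1 \<noteq> {}"
    by (rule hitting_set[OF fin(1) finite.emptyI 1]) auto
  have 2: "card X1 < card S" if "S \<in> B1" for S using big(1)[of S] that X1 by simp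
  obtain Y1 where Y1: "Y1 \<subseteq> \<Union>B1" "Y1 \<inter> X1 = {}" "card Y1 \<le> card B1" "finite Y1" "\<And>S. S \<in> B1 \<Longrightarrow> S \<inter> Y1 \<noteq> {}"
    by (rule hitting_set[OF fin(2) X1(3) 2]) auto
  have 3: "card Y1 < card S" if "S \<in> A2" for S using big(2)[of S] that Y1 le by simp
  obtain X2 where X2: "X2 \<subseteq> \<Union>A2" "X2 \<inter> Y1 = {}" "card X2 \<le> card A2" "finite X2" "\<And>S. S \<in> A2 \<Longrightarrow> S \<inter> X2 \<noteq> {}"
    by (rule hitting_set[OF fin(3) Y1(4) 3]) auto
  have 4: "card (X1 \<union> X2) < card S" if "S \<in> B2" for S
    using big(2)[of S] that X1 X2 le card_Un_le[of X1 X2] by simp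
  obtain Y2 where Y2: "Y2 \<subseteq> \<Union>B2" "Y2 \<inter> (X1 \<union> X2) = {}" "card Y2 \<le> card B2" "\<And>S. S \<in> B2 \<Longrightarrow> S \<inter> Y2 \<noteq> {}"
    by (rule hitting_set[OF fin(4) _ 4]) (use X1(3) X2(4) in auto)
  have "card (Y1 \<union> Y2) \<le> card B1 + card B2" using card_Un_le[of Y1 Y2] Y1 Y2 by linarith
  moreover have "(X1 \<union> X2) \<inter> (Y1 \<union> Y2) = {}" using Y1(2) X2(2) Y2(2) by blast
  moreover have "S \<inter> (X1 \<union> X2) \<noteq> {}" if "S \<in> A1 \<union> A2" for S using that X1(4) X2(5) by blast
  moreover have "S \<inter> (Y1 \<union> Y2) \<noteq> {}" if "S \<in> B1 \<union> B2" for S using that Y1(5) Y2(4) by blast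
  ultimately show ?thesis
    using X1(1) X2(1) Y1(1) Y2(1) by (intro exI[of _ "X1 \<union> X2"] exI[of _ "Y1 \<union> Y2"]) auto
qed

text \<open>Two disjoint sets, hitting the members of two families each. The sizes required in the two
  groups (index 1 and index 2) are unrelated: choosing greedily for the group with fewer members first leaves
  enough room in the other one. The groups will stand for in- and out-neighbourhoods, whose minimal
  sizes may differ arbitrarily.\<close>

lemma disjoint_hitting_sets:
  assumes fin: "finite A1" "finite B1" "finite A2" "finite B2"
    and big: "\<And>S. S \<in> A1 \<union> B1 \<Longrightarrow> 2 * (card A1 + card B1) < card S"
      "\<And>S. S \<in> A2 \<union> B2 \<Longrightarrow> 2 * (card A2 + card B2) < card S"
  shows "\<exists>X Y. X \<inter> Y = {} \<and> X \<subseteq> \<Union>(A1 \<union> A2) \<and> Y \<subseteq> \<Union>(B1 \<union> B2) \<and> card Y \<le> card B1 + card B2 \<and>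
           (\<forall>S\<in>A1 \<union> A2. S \<inter> X \<noteq> {}) \<and> (\<forall>S\<in>B1 \<union> B2. S \<inter> Y \<noteq> {})"
proof (cases "card A1 + card B1 \<le> card A2 + card B2")
  case True
  then show ?thesis using disjoint_hitting_sets_aux[OF assms] by blast
next
  case False
  then show ?thesis using disjoint_hitting_sets_aux[OF fin(3,4,1,2) big(2,1)]
    by (simp add: Un_commute add.commute)
qed

section \<open>Gadgets and cores\<close>

text \<open>In the applications \<open>F\<close> is the set covered by a fan and \<open>F'\<close> the set covered by a fan of the
  converse, so that an attached vertex is at most two arcs away from either fan.\<close>

definition attached :: "('a \<Rightarrow> 'a \<Rightarrow> bool) \<Rightarrow> 'a set \<Rightarrow> 'a set \<Rightarrow> 'a set \<Rightarrow> 'a \<Rightarrow> bool" where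
  "attached r X F F' x \<longleftrightarrow>
     (x \<in> F \<or> (\<exists>y\<in>X \<inter> F. r y x)) \<and> (x \<in> F' \<or> (\<exists>y\<in>X \<inter> F'. r x y))"

lemma attached_mono: "attached r X F F' x \<Longrightarrow> X \<subseteq> Y \<Longrightarrow> attached r Y F F' x"
  by (auto simp: attached_def)

lemma reach_from_source:
  assumes "D \<subseteq> X" "w \<in> D" "\<forall>y\<in>D. y = w \<or> r w y"
    and "x \<in> X" "x \<in> cover r D \<or> (\<exists>y\<in>X \<inter> cover r D. r y x)"
  shows "reach r X w x"
proof -
  have 1: "reach r X w y" if "y \<in> D" for y
    using that assms(1-3) by (cases "y = w") (auto intro: reach_step)
  have 2: "reach r X w y" if y: "y \<in> cover r D" "y \<in> X" for y
  proof (cases "y \<in> D")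
    case False
    then obtain d where "d \<in> D" "r d y" using y by (auto simp: cover_def)
    then show ?thesis using 1 assms(1) y reach_step[of d X y r] reach_trans by fastforce
  qed (rule 1)
  from assms(5) show ?thesis
  proof
    assume "\<exists>y\<in>X \<inter> cover r D. r y x"
    then obtain y where "y \<in> X" "y \<in> cover r D" "r y x" by blast
    then show ?thesis using 2[of y] reach_step[of y X x r] assms(4) reach_trans by fastforce
  qed (use 2 assms(4) in blast)
qed

text \<open>The source \<open>w\<close> reaches all attached vertices, all attached vertices reach the sink \<open>z\<close>, and a single
  connection from \<open>z\<close> to \<open>w\<close> closes the circle. The vertices of this connection are the ones for which
  the second alternative is meant.\<close>

lemma strong_if_attached:
  assumes D: "D \<subseteq> X" "w \<in> D" "\<forall>y\<in>D. y = w \<or> r w y"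
    and D': "D' \<subseteq> X" "z \<in> D'" "\<forall>y\<in>D'. y = z \<or> r y z"
    and zw: "reach r X z w"
    and att: "attached r X (cover r D) (cover r\<inverse>\<inverse> D') z"
      "\<And>x. x \<in> X \<Longrightarrow> attached r X (cover r D) (cover r\<inverse>\<inverse> D') x \<or> (reach r X z x \<and> reach r X x w)"
  shows "strong r X"
proof -
  have wx: "reach r X w x" if "x \<in> X" "attached r X (cover r D) (cover r\<inverse>\<inverse> D') x" for x
    using that D reach_from_source[of D X w r x] by (auto simp: attached_def)
  have xz: "reach r X x z" if "x \<in> X" "attached r X (cover r D) (cover r\<inverse>\<inverse> D') x" for x
    using that reach_from_source[of D' X z "r\<inverse>\<inverse>" x] D' by (auto simp: attached_def reach_conversep)
  have wz: "reach r X w z" using wx[of z] att(1) D' by blast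
  have "reach r X w x \<and> reach r X x w" if x: "x \<in> X" for x
    using att(2)[OF x] wx[OF x] xz[OF x] wz zw reach_trans[of r X] by blast
  then show ?thesis unfolding strong_def using reach_trans[of r X] by blast
qed

context tournament_rel
begin

text \<open>The vertices of \<open>A\<close> are to be avoided. Outside \<open>A\<close> and \<open>F\<close> there are too few vertices for all
  in-neighbours of \<open>x\<close>.\<close>

lemma in_neighbour_in_cover:
  assumes "U \<subseteq> V" "8 * card (U - F) \<le> card {y. r y x}" "m \<le> card {y. r y x}"
    and "finite A" "V - U \<subseteq> A" "8 * card A < 7 * m"
  shows "\<exists>g\<in>F - A. r g x"
proof (rule ccontr)
  assume n: "\<not> ?thesis"
  have "{y. r y x} \<subseteq> A \<union> (U - F)" using n arc_in[of _ x] assms(5) by auto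
  then have "card {y. r y x} \<le> card (A \<union> (U - F))"
    using assms(4) finite_sub[OF assms(1)] by (intro card_mono) auto
  also have "\<dots> \<le> card A + card (U - F)" by (rule card_Un_le)
  finally show False using assms(2,3,6) by linarith
qed

text \<open>Every vertex \<open>x\<close> can be attached by four further vertices that attach each other: a covered
  in-neighbour \<open>g\<close> of \<open>x\<close> with a suitable out-neighbour \<open>h\<close>, and dually an out-neighbour \<open>g'\<close> of \<open>x\<close> with
  an in-neighbour \<open>h'\<close>. Nothing more is required of \<open>h\<close>, since its in-neighbour \<open>g\<close> is covered.\<close>

lemma gadgets:
  assumes U: "U \<subseteq> V" "S \<subseteq> U"
    and deg: "\<And>x. x \<in> U \<Longrightarrow> 8 * card (U - F) \<le> card {y. r y x}"
      "\<And>x. x \<in> U \<Longrightarrow> 8 * card (U - F') \<le> card {y. r x y}"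
      "\<And>x. x \<in> U \<Longrightarrow> m \<le> card {y. r y x}" "\<And>x. x \<in> U \<Longrightarrow> m \<le> card {y. r x y}"
    and A: "finite A" "V - U \<subseteq> A" "8 * card A < 7 * m"
  shows "\<exists>G \<subseteq> V - A. card G \<le> 4 * card S \<and> (\<forall>g\<in>G. attached r G F F' g) \<and>
           (\<forall>x\<in>S. (\<exists>g\<in>G \<inter> F. r g x) \<and> (\<exists>g\<in>G \<inter> F'. r x g))"
proof -
  interpret conv: tournament_rel V "r\<inverse>\<inverse>" by (rule tournament_rel_conversep)
  have i: "\<exists>g\<in>F - A. r g x" if "x \<in> U" for x
    using in_neighbour_in_cover[OF U(1) deg(1,3) A] that by blast
  have o: "\<exists>g\<in>F' - A. r x g" if "x \<in> U" for x
    using conv.in_neighbour_in_cover[of U F' x m A] deg(2,4)[OF that] A U by simp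
  have "\<exists>G \<subseteq> V - A. card G \<le> 4 \<and> (\<forall>g\<in>G. attached r G F F' g) \<and>
           (\<exists>g\<in>G \<inter> F. r g x) \<and> (\<exists>g\<in>G \<inter> F'. r x g)" if x: "x \<in> S" for x
  proof -
    obtain g where g: "g \<in> F - A" "r g x" using i x U by blast
    then have gU: "g \<in> U" using arc_in A by blast
    obtain h where h: "h \<in> F' - A" "r g h" using o gU by blast
    obtain g' where g': "g' \<in> F' - A" "r x g'" using o x U by blast
    then have gU': "g' \<in> U" using arc_in A by blast
    obtain h' where h': "h' \<in> F - A" "r h' g'" using i gU' by blast
    have "card {g, h, g', h'} \<le> 4" using card_length[of "[g, h, g', h']"] by simp
    then show ?thesis using g h g' h' arc_in
      by (intro exI[of _ "{g, h, g', h'}"]) (auto simp: attached_def)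
  qed
  then obtain G where G: "\<And>x. x \<in> S \<Longrightarrow> G x \<subseteq> V - A" "\<And>x. x \<in> S \<Longrightarrow> card (G x) \<le> 4"
    "\<And>x g. x \<in> S \<Longrightarrow> g \<in> G x \<Longrightarrow> attached r (G x) F F' g"
    "\<And>x. x \<in> S \<Longrightarrow> (\<exists>g\<in>G x \<inter> F. r g x) \<and> (\<exists>g\<in>G x \<inter> F'. r x g)" by metis
  have fS: "finite S" using U finite_sub by blast
  have "card (\<Union>x\<in>S. G x) \<le> (\<Sum>x\<in>S. card (G x))" by (rule card_UN_le[OF fS])
  also have "\<dots> \<le> (\<Sum>x\<in>S. 4)" using G(2) by (intro sum_mono) auto
  finally have "card (\<Union>x\<in>S. G x) \<le> 4 * card S" by simp
  moreover have "attached r (\<Union>x\<in>S. G x) F F' g" if "g \<in> (\<Union>x\<in>S. G x)" for g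
    using that G(3) by (auto intro: attached_mono)
  moreover have "(\<Union>x\<in>S. G x) \<subseteq> V - A" using G(1) by blast
  moreover have "(\<exists>g\<in>(\<Union>x\<in>S. G x) \<inter> F. r g x) \<and> (\<exists>g\<in>(\<Union>x\<in>S. G x) \<inter> F'. r x g)"
    if "x \<in> S" for x using G(4)[OF that] that by blast
  ultimately show ?thesis by (intro exI[of _ "\<Union>x\<in>S. G x"] conjI ballI) auto
qed

text \<open>After moving one of \<open>x\<close> and \<open>y\<close> forward along an arc, they have many common out-neighbours. Let \<open>X\<close>
  consist of \<open>c\<close> out-neighbours of \<open>x\<close>. If one of them has \<open>c\<close> out-neighbours among those of \<open>y\<close>, then \<open>x\<close>
  moves there; otherwise few out-neighbours of \<open>y\<close> are dominated from \<open>X\<close>, and \<open>y\<close> moves to one of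
  the others, which dominates \<open>X\<close>.\<close>

lemma common_out_neighbours:
  assumes "finite A" "m \<le> card {u. r x u}" "m \<le> card {u. r y u}" "c * c + c + card A < m"
  shows "\<exists>x' y'. (x' = x \<and> y' \<notin> A \<and> r y y' \<or> y' = y \<and> x' \<notin> A \<and> r x x') \<and>
           c \<le> card {u. r x' u \<and> r y' u}"
proof -
  have "c \<le> card ({u. r x u} - A)"
    using diff_card_le_card_Diff[OF assms(1), of "{u. r x u}"] assms(2,4) by linarith
  then obtain X where X: "X \<subseteq> {u. r x u} - A" "card X = c" "finite X"
    by (rule obtain_subset_with_card_n)
  show ?thesis
  proof (cases "\<exists>a\<in>X. c \<le> card {u. r a u \<and> r y u}")
    case True
    then show ?thesis using X by blast
  next
    case False
    let ?B = "A \<union> X \<union> (\<Union>a\<in>X. {u. r a u \<and> r y u})"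
    have "card (\<Union>a\<in>X. {u. r a u \<and> r y u}) \<le> (\<Sum>a\<in>X. card {u. r a u \<and> r y u})"
      by (rule card_UN_le[OF X(3)])
    also have "\<dots> \<le> (\<Sum>a\<in>X. c)" using False by (intro sum_mono) auto
    finally have "card ?B \<le> card A + c + c * c"
      using card_Un_le[of "A \<union> X" "\<Union>a\<in>X. {u. r a u \<and> r y u}"] card_Un_le[of A X] X(2) by simp
    then have "card ?B < card {u. r y u}" using assms(3,4) by linarith
    moreover have "finite ?B" using assms(1) X(3) by (auto intro: finite_subset[OF _ finite_out[of y]])
    ultimately have "\<not> {u. r y u} \<subseteq> ?B" using card_mono by (metis leD)
    then obtain b where b: "r y b" "b \<notin> ?B" by blast
    then have "X \<subseteq> {u. r x u \<and> r b u}" using X(1) total[of b] arc_in by blast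
    then have "c \<le> card {u. r x u \<and> r b u}"
      using X(2) card_mono[of "{u. r x u \<and> r b u}" X] finite_out[of x] by (auto intro: finite_subset)
    then show ?thesis using b by blast
  qed
qed

end

text \<open>A core of a colour class: a fan and a fan of the converse, with everything attached within the core.
  All it lacks for being strong is a path from the exit \<open>s\<close> to the entry \<open>e\<close>.\<close>

definition core :: "('a \<Rightarrow> 'a \<Rightarrow> bool) \<Rightarrow> 'a set \<Rightarrow> 'a set \<Rightarrow> 'a set \<Rightarrow> 'a \<Rightarrow> 'a set \<Rightarrow> 'a \<Rightarrow> 'a \<Rightarrow> 'a \<Rightarrow> bool" where
  "core r U K D w D' z s e \<longleftrightarrow>
     fan r U D w \<and> fan r\<inverse>\<inverse> U D' z \<and> D \<subseteq> K \<and> D' \<subseteq> K \<and>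
     (\<forall>x\<in>K. attached r K (cover r D) (cover r\<inverse>\<inverse> D') x) \<and>
     s \<in> K \<and> e \<in> K \<and> reach r K z s \<and> reach r K e w"

lemma coreD:
  assumes "core r U K D w D' z s e"
  shows "D \<subseteq> K" "D' \<subseteq> K" "s \<in> K" "e \<in> K"
    and "\<And>x. x \<in> U \<Longrightarrow> 8 * card (U - cover r D) \<le> card {y. r y x}"
    and "\<And>x. x \<in> U \<Longrightarrow> 8 * card (U - cover r\<inverse>\<inverse> D') \<le> card {y. r x y}"
  using assms by (auto simp: core_def fan_def)

lemma kstrong_conversep: "kstrong r\<inverse>\<inverse> H k \<longleftrightarrow> kstrong r H k"
  by (simp add: kstrong_def strong_conversep)

lemma core_strong:
  assumes "core r U K D w D' z s e" "K \<subseteq> X" "reach r X s e"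
    and "\<And>x. x \<in> X - K \<Longrightarrow>
      attached r X (cover r D) (cover r\<inverse>\<inverse> D') x \<or> (reach r X s x \<and> reach r X x e)"
  shows "strong r X"
proof (rule strong_if_attached[of D X w r D' z])
  note c = assms(1)[unfolded core_def fan_def]
  show "D \<subseteq> X" "w \<in> D" "\<forall>y\<in>D. y = w \<or> r w y" "D' \<subseteq> X" "z \<in> D'" "\<forall>y\<in>D'. y = z \<or> r y z"
    using c assms(2) by auto
  have zs: "reach r X z s" and ew: "reach r X e w" using c assms(2) reach_mono by metis+
  show "reach r X z w" using zs ew assms(3) reach_trans by metis
  have att: "attached r X (cover r D) (cover r\<inverse>\<inverse> D') x" if "x \<in> K" for x
    using c that assms(2) attached_mono by metis
  show "attached r X (cover r D) (cover r\<inverse>\<inverse> D') z" using att c by blast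
  fix x assume "x \<in> X"
  then show "attached r X (cover r D) (cover r\<inverse>\<inverse> D') x \<or> (reach r X z x \<and> reach r X x w)"
    using att assms(4)[of x] zs ew reach_trans[of r X] by blast
qed

text \<open>Here \<open>N\<close> is a neighbourhood, \<open>Z\<close> consists of the cores, \<open>P1\<close> and \<open>P2\<close> are shortest paths and \<open>E\<close> is the set of
  exceptional vertices. They occupy at most \<open>400 + 2 * (5 + card N / 1000) + card N / 8\<close> elements of \<open>N\<close>,
  which is less than half.\<close>

lemma remainder_large:
  fixes N L Z P1 P2 E :: "'a set"
  assumes "N \<subseteq> L \<union> Z \<union> P1 \<union> P2 \<union> E" "finite N" "finite L" "finite Z" "finite E"
    and "card Z \<le> 400" "1000 * (card (N \<inter> P1) - 5) \<le> card N" "1000 * (card (N \<inter> P2) - 5) \<le> card N"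
    and "8 * card E \<le> card N" "1000000 \<le> card N"
  shows "card N < 2 * card L"
proof -
  have "card N \<le> card (L \<union> Z \<union> (N \<inter> P1) \<union> (N \<inter> P2) \<union> E)"
    using assms(1-5) by (intro card_mono) auto
  also have "\<dots> \<le> card L + card Z + card (N \<inter> P1) + card (N \<inter> P2) + card E"
    by (intro order_trans[OF card_Un_le] add_mono order_refl)
  finally show ?thesis using assms(6-10) by linarith
qed

context tournament_rel
begin

text \<open>Deleting all in-neighbours of \<open>x\<close> makes \<open>x\<close> unreachable.\<close>

lemma kstrong_indegree:
  assumes "kstrong r V k" "k < card V" "x \<in> V"
  shows "k \<le> card {y. r y x}"
proof (rule ccontr)
  let ?S = "{y. r y x}"
  assume n: "\<not> k \<le> card ?S"
  have S: "?S \<subseteq> V" using arc_in by auto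
  then have st: "strong r (V - ?S)" using assms(1) n by (auto simp: kstrong_def)
  have "card (insert x ?S) < card V" using n assms(2) card_insert_le_m1[of "Suc (card ?S)" ?S x] by simp
  then have "\<not> V \<subseteq> insert x ?S" using card_mono[of "insert x ?S" V] by fastforce
  then obtain y where y: "y \<in> V" "y \<noteq> x" "\<not> r y x" by blast
  have "V - ?S \<subseteq> V - ?S - {x}"
    by (rule strong_closed[OF st, of y]) (use y in auto)
  then show False using assms(3) irr by blast
qed

lemma kstrong_outdegree:
  assumes "kstrong r V k" "k < card V" "x \<in> V"
  shows "k \<le> card {y. r x y}"
  using tournament_rel.kstrong_indegree[OF tournament_rel_conversep] assms by (simp add: kstrong_conversep)

text \<open>Disjoint cores for two colour classes \<open>A\<close> and \<open>B\<close>, to which the vertices of \<open>SA\<close> and \<open>SB\<close> are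
  preassigned. The gadgets in \<open>KB\<close> also attach the vertices of \<open>KA - SA\<close>, because class \<open>A\<close> will be
  allowed to shrink, and then these vertices may fall to \<open>B\<close>. The common neighbours of the two exits and
  of the two entries are there for the following reason. The path that connects \<open>sB\<close> to \<open>eB\<close> is chosen first
  and could use up all out-neighbours of \<open>sA\<close> or all in-neighbours of \<open>eA\<close>; but it uses at most two
  out-neighbours of its own start and two in-neighbours of its own end.\<close>

lemma cores_exist:
  assumes ks: "kstrong r V k" "k < card V" "1000000 \<le> k"
    and S: "SA \<subseteq> V" "SB \<subseteq> V" "SA \<inter> SB = {}" "card SA + card SB \<le> 1"
  obtains UA KA DA wA DA' zA sA eA UB KB DB wB DB' zB sB eB where
    "core r UA KA DA wA DA' zA sA eA" "core r UB KB DB wB DB' zB sB eB"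
    "UA \<subseteq> V" "UB \<subseteq> V" "KA \<subseteq> V" "KB \<subseteq> V" "KA \<inter> KB = {}" "SA \<subseteq> KA" "SB \<subseteq> KB"
    "V - (KA \<union> KB) \<subseteq> UA \<inter> UB" "card (KA \<union> KB) \<le> 400"
    "\<forall>x\<in>KA - SA. (\<exists>y\<in>KB. r y x) \<and> (\<exists>y\<in>KB. r x y)"
    "500 \<le> card {u. r sA u \<and> r sB u}" "500 \<le> card {u. r u eA \<and> r u eB}"
proof -
  interpret conv: tournament_rel V "r\<inverse>\<inverse>" by (rule tournament_rel_conversep)
  have din: "k \<le> card {y. r y x}" if "x \<in> V" for x by (rule kstrong_indegree[OF ks(1,2) that])
  have dout: "k \<le> card {y. r x y}" if "x \<in> V" for x by (rule kstrong_outdegree[OF ks(1,2) that])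
  have fS: "finite SA" "finite SB" using S finite_sub by auto
  have cS: "card SA \<le> 1" "card SB \<le> 1" using S(4) by auto
  \<comment> \<open>the fans for \<open>B\<close> come first, so that \<open>UB\<close> contains all vertices that the gadgets in \<open>KB\<close> have to
    attach, in particular the fans for \<open>A\<close>\<close>
  define UB where "UB = V - SA"
  have "card SA < card V" using S ks by linarith
  then have UBne: "UB \<noteq> {}" unfolding UB_def using fS(1) card_mono[of SA V] by fastforce
  have UB: "UB \<subseteq> V" by (auto simp: UB_def)
  obtain DB wB where DB: "fan r UB DB wB" using fan_exists[OF UB UBne] by blast
  obtain DB' zB where DB': "fan r\<inverse>\<inverse> UB DB' zB" using conv.fan_exists[OF UB UBne] by blast
  have B1: "DB \<subseteq> UB" "wB \<in> DB" "card DB \<le> 4" "DB' \<subseteq> UB" "zB \<in> DB'" "card DB' \<le> 4"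
    using DB DB' by (auto simp: fan_def)
  define QB where "QB = DB \<union> DB' \<union> SB"
  define UA where "UA = V - QB"
  have UA: "UA \<subseteq> V" by (auto simp: UA_def)
  have QB: "finite QB" "QB \<subseteq> V" using B1 UB S(2) finite_sub[of QB] by (auto simp: QB_def)
  have "card QB \<le> card DB + card DB' + card SB"
    unfolding QB_def by (intro order_trans[OF card_Un_le] add_mono order_refl)
  then have cQB: "card QB \<le> 9" using B1 cS by linarith
  then have "card QB < card V" using ks by linarith
  then have UAne: "UA \<noteq> {}" unfolding UA_def using QB(1) card_mono[of QB V] by fastforce
  obtain DA wA where DA: "fan r UA DA wA" using fan_exists[OF UA UAne] by blast
  obtain DA' zA where DA': "fan r\<inverse>\<inverse> UA DA' zA" using conv.fan_exists[OF UA UAne] by blast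
  have A1: "DA \<subseteq> UA" "wA \<in> DA" "card DA \<le> 4" "DA' \<subseteq> UA" "zA \<in> DA'" "card DA' \<le> 4"
    using DA DA' by (auto simp: fan_def)
  define QA where "QA = DA \<union> DA' \<union> SA"
  have QA: "finite QA" "QA \<subseteq> UA" using A1 UA S B1 finite_sub[of QA]
    by (auto simp: QA_def UA_def QB_def UB_def)
  have "card QA \<le> card DA + card DA' + card SA"
    unfolding QA_def by (intro order_trans[OF card_Un_le] add_mono order_refl)
  then have cQA: "card QA \<le> 9" using A1 cS by linarith
  have dj: "QA \<inter> QB = {}" using QA by (auto simp: UA_def)
  have inQ: "zA \<in> QA" "wA \<in> QA" "zB \<in> QB" "wB \<in> QB" using A1 B1 by (auto simp: QA_def QB_def)
  have inV: "zA \<in> V" "wA \<in> V" "zB \<in> V" "wB \<in> V" using inQ QA QB UA by auto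
  have cQ: "card (QA \<union> QB) \<le> 18" using card_Un_le[of QA QB] cQA cQB by linarith
  \<comment> \<open>exits and entries with many common neighbours\<close>
  obtain sA sB where s: "sA = zA \<and> sB \<notin> QA \<union> QB \<and> r zB sB \<or> sB = zB \<and> sA \<notin> QA \<union> QB \<and> r zA sA"
    and scard: "500 \<le> card {u. r sA u \<and> r sB u}"
    using common_out_neighbours[of "QA \<union> QB" k zA zB 500] QA QB dout inV cQ ks by auto
  let ?Q = "insert sA (insert sB (QA \<union> QB))"
  have "card ?Q \<le> 20"
    using cQ card_insert_le_m1[of 20 "insert sB (QA \<union> QB)" sA] card_insert_le_m1[of 19 "QA \<union> QB" sB] by simp
  then obtain eA eB where e: "eA = wA \<and> eB \<notin> ?Q \<and> r eB wB \<or> eB = wB \<and> eA \<notin> ?Q \<and> r eA wA"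
    and ecard: "500 \<le> card {u. r u eA \<and> r u eB}"
    using conv.common_out_neighbours[of ?Q k wA wB 500] QA QB din inV ks by auto
  have V4: "sA \<in> V" "sB \<in> V" "eA \<in> V" "eB \<in> V" using s e inV arc_in by blast+
  define RA where "RA = QA \<union> {sA, eA}"
  define RB where "RB = QB \<union> {sB, eB}"
  have RdJ: "RA \<inter> RB = {}" using s e dj inQ by (auto simp: RA_def RB_def)
  have RA: "RA \<subseteq> UA" "finite RA" "card RA \<le> 11"
  proof -
    show "RA \<subseteq> UA" using QA V4 s e dj inQ by (auto simp: RA_def UA_def)
    show "finite RA" using QA by (simp add: RA_def)
    have "card RA \<le> card QA + card {sA, eA}" unfolding RA_def by (rule card_Un_le)
    moreover have "card {sA, eA} \<le> 2" using card_length[of "[sA, eA]"] by simp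
    ultimately show "card RA \<le> 11" using cQA by linarith
  qed
  have RB: "RB \<subseteq> V" "finite RB" "card RB \<le> 11"
  proof -
    show "RB \<subseteq> V" "finite RB" using QB V4 by (auto simp: RB_def)
    have "card RB \<le> card QB + card {sB, eB}" unfolding RB_def by (rule card_Un_le)
    moreover have "card {sB, eB} \<le> 2" using card_length[of "[sB, eB]"] by simp
    ultimately show "card RB \<le> 11" using cQB by linarith
  qed
  \<comment> \<open>gadgets for \<open>A\<close> avoiding \<open>RB\<close>, and afterwards gadgets for \<open>B\<close> avoiding all of \<open>KA\<close>\<close>
  let ?FA = "cover r DA" and ?FA' = "cover r\<inverse>\<inverse> DA'" and ?FB = "cover r DB" and ?FB' = "cover r\<inverse>\<inverse> DB'"
  have "\<exists>G \<subseteq> V - RB. card G \<le> 4 * card RA \<and> (\<forall>g\<in>G. attached r G ?FA ?FA' g) \<and>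
           (\<forall>x\<in>RA. (\<exists>g\<in>G \<inter> ?FA. r g x) \<and> (\<exists>g\<in>G \<inter> ?FA'. r x g))"
    by (rule gadgets[OF UA RA(1), where m = k])
       (use DA DA' din dout UA RB ks in \<open>auto simp: fan_def UA_def RB_def\<close>)
  then obtain GA where GA: "GA \<subseteq> V - RB" "card GA \<le> 4 * card RA" "\<forall>g\<in>GA. attached r GA ?FA ?FA' g"
    "\<forall>x\<in>RA. (\<exists>g\<in>GA \<inter> ?FA. r g x) \<and> (\<exists>g\<in>GA \<inter> ?FA'. r x g)" by blast
  define KA where "KA = RA \<union> GA"
  have KA: "KA \<subseteq> V" "finite KA" "card KA \<le> 55" "KA \<inter> RB = {}"
    using RA UA GA RdJ finite_sub[of KA] card_Un_le[of RA GA] by (auto simp: KA_def)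
  have attA: "\<forall>x\<in>KA. attached r KA ?FA ?FA' x"
    using GA(3,4) by (fastforce simp: KA_def attached_def)
  have SAK: "SA \<subseteq> KA" by (auto simp: KA_def RA_def QA_def)
  let ?S = "RB \<union> (KA - SA)"
  have SUB: "?S \<subseteq> UB" using RB KA RdJ SAK by (auto simp: UB_def)
  have cS: "card ?S \<le> 66"
    using card_Un_le[of RB "KA - SA"] card_mono[OF KA(2), of "KA - SA"] RB KA by fastforce
  have "\<exists>G \<subseteq> V - KA. card G \<le> 4 * card ?S \<and> (\<forall>g\<in>G. attached r G ?FB ?FB' g) \<and>
           (\<forall>x\<in>?S. (\<exists>g\<in>G \<inter> ?FB. r g x) \<and> (\<exists>g\<in>G \<inter> ?FB'. r x g))"
    by (rule gadgets[OF UB SUB, where m = k])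
       (use DB DB' din dout UB KA SAK ks in \<open>auto simp: fan_def UB_def\<close>)
  then obtain GB where GB: "GB \<subseteq> V - KA" "card GB \<le> 4 * card ?S" "\<forall>g\<in>GB. attached r GB ?FB ?FB' g"
    "\<forall>x\<in>?S. (\<exists>g\<in>GB \<inter> ?FB. r g x) \<and> (\<exists>g\<in>GB \<inter> ?FB'. r x g)" by blast
  define KB where "KB = RB \<union> GB"
  have attB: "\<forall>x\<in>KB. attached r KB ?FB ?FB' x"
    using GB(3,4) by (fastforce simp: KB_def attached_def)
  have "card KB \<le> 275" using card_Un_le[of RB GB] RB(3) GB(2) cS by (simp add: KB_def)
  then have cK: "card (KA \<union> KB) \<le> 400" using card_Un_le[of KA KB] KA(3) by linarith
  have inA: "zA \<in> KA" "wA \<in> KA" "sA \<in> KA" "eA \<in> KA" "DA \<subseteq> KA" "DA' \<subseteq> KA"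
    using A1 by (auto simp: KA_def RA_def QA_def)
  have inB: "zB \<in> KB" "wB \<in> KB" "sB \<in> KB" "eB \<in> KB" "DB \<subseteq> KB" "DB' \<subseteq> KB"
    using B1 by (auto simp: KB_def RB_def QB_def)
  have "reach r KA zA sA" "reach r KA eA wA"
    using s e inA reach_step[of zA KA sA r] reach_step[of eA KA wA r] by auto
  then have "core r UA KA DA wA DA' zA sA eA"
    unfolding core_def using DA DA' attA inA by blast
  moreover have "reach r KB zB sB" "reach r KB eB wB"
    using s e inB reach_step[of zB KB sB r] reach_step[of eB KB wB r] by auto
  then have "core r UB KB DB wB DB' zB sB eB"
    unfolding core_def using DB DB' attB inB by blast
  moreover have "KB \<subseteq> V" "KA \<inter> KB = {}" "SB \<subseteq> KB"
    using RB GB KA by (auto simp: KB_def RB_def QB_def)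
  moreover have "V - (KA \<union> KB) \<subseteq> UA \<inter> UB" using SAK by (auto simp: KB_def RB_def UA_def UB_def)
  moreover have "\<forall>x\<in>KA - SA. (\<exists>y\<in>KB. r y x) \<and> (\<exists>y\<in>KB. r x y)" using GB(4) by (fastforce simp: KB_def)
  ultimately show thesis using that UA UB KA(1) SAK cK scard ecard by presburger
qed

end

section \<open>A robust partition\<close>

context tournament_rel
begin

lemma in_out_degree_le:
  assumes "x \<in> V"
  shows "card {y. r y x} + card {y. r x y} \<le> card V"
proof -
  have "card {y. r y x} + card {y. r x y} = card ({y. r y x} \<union> {y. r x y})"
    using asym by (intro card_Un_disjoint[symmetric]) auto
  also have "\<dots> \<le> card V" using arc_in by (intro card_mono fin) auto
  finally show ?thesis .
qed

text \<open>By the last condition every superset of \<open>B\<close> that avoids \<open>SA\<close> is strong.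

  To obtain \<open>B\<close>, take disjoint cores \<open>KA\<close> and \<open>KB\<close> and connect their ends by shortest paths, first \<open>PB\<close>
  and then \<open>PA\<close> in what is left. Let \<open>T1\<close> consist of the vertices outside the cores and \<open>PB\<close>, and let
  \<open>T2 = T1 - PA\<close>. A vertex of \<open>T1\<close> that is not covered by one of the fans has more than half of its
  neighbourhood in the covered part of \<open>T2\<close>, because at most an eighth is not covered and both paths are
  sparse. There are few such vertices compared with that, so there are disjoint sets \<open>WA\<close> and \<open>WB\<close> in
  \<open>T2\<close> that attach all of them to \<open>A\<close> and to \<open>B\<close>, respectively. Then \<open>B = KB \<union> PB \<union> WB\<close> and its complement
  are strong.

  The order of the two paths matters. The vertices of \<open>PA\<close> may fall to \<open>B\<close> later and therefore have
  to be attached to \<open>B\<close>; this works since they belong to both tournaments in which the paths are shortest, so that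
  neither path is dense in their neighbourhoods. The vertices of \<open>PB\<close>, for which this is not known, remain in
  \<open>B\<close> and are reached along the path.\<close>

lemma robust_partition:
  assumes ks: "kstrong r V k" "k < card V" "1000000 \<le> k"
    and S: "SA \<subseteq> V" "SB \<subseteq> V" "SA \<inter> SB = {}" "card SA + card SB \<le> 1"
  shows "\<exists>B. SB \<subseteq> B \<and> B \<subseteq> V - SA \<and> 2 * card B \<le> card V \<and> strong r B \<and> strong r (V - B) \<and>
    (\<forall>x\<in>V - B - SA. (\<exists>y\<in>B. r y x) \<and> (\<exists>y\<in>B. r x y))"
proof -
  have din: "k \<le> card {y. r y x}" if "x \<in> V" for x by (rule kstrong_indegree[OF ks(1,2) that])
  have dout: "k \<le> card {y. r x y}" if "x \<in> V" for x by (rule kstrong_outdegree[OF ks(1,2) that])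
  obtain UA KA DA wA DA' zA sA eA UB KB DB wB DB' zB sB eB where
    coreA: "core r UA KA DA wA DA' zA sA eA" and coreB: "core r UB KB DB wB DB' zB sB eB"
    and sub: "UA \<subseteq> V" "UB \<subseteq> V" "KA \<subseteq> V" "KB \<subseteq> V" "KA \<inter> KB = {}" "SA \<subseteq> KA" "SB \<subseteq> KB"
    and KU: "V - (KA \<union> KB) \<subseteq> UA \<inter> UB" and cK: "card (KA \<union> KB) \<le> 400"
    and KAnb: "\<forall>x\<in>KA - SA. (\<exists>y\<in>KB. r y x) \<and> (\<exists>y\<in>KB. r x y)"
    and scard: "500 \<le> card {u. r sA u \<and> r sB u}" and ecard: "500 \<le> card {u. r u eA \<and> r u eB}"
    by (rule cores_exist[OF assms])
  note cA = coreD[OF coreA] and cB = coreD[OF coreB]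
  define Z where "Z = KA \<union> KB"
  have Z: "finite Z" "Z \<subseteq> V" "card Z \<le> 400"
    using sub cK finite_sub[of Z] by (auto simp: Z_def)
  define H where "H = V - (Z - {sB, eB})"
  have kH: "kstrong r H (k - 400)" unfolding H_def
    by (rule kstrong_Diff[OF ks(1) fin])
       (use Z card_mono[of Z "Z - {sB, eB}"] in auto)
  have H: "H \<subseteq> V" "finite H" using finite_sub[of H] by (auto simp: H_def)
  have seB: "sB \<in> KB" "eB \<in> KB" and seA: "sA \<in> KA" "eA \<in> KA" using cA(3,4) cB(3,4) by blast+
  have seH: "sB \<in> H" "eB \<in> H" using seB sub by (auto simp: H_def)
  have "strong r H" using kstrong_strong[OF kH] ks by simp
  from geodesic_exists[OF this seH] obtain p l f where
    p: "geodesic r H p l f" "p 0 = sB" "p l = eB" by blast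
  define PB where "PB = p ` {..l}"
  have PB: "PB \<subseteq> H" "finite PB" "sB \<in> PB" "eB \<in> PB"
    using geodesicD(1)[OF p(1)] p(2,3) by (auto simp: PB_def image_iff intro: bexI[of _ 0] bexI[of _ l])
  define T1 where "T1 = H - PB"
  have T1: "T1 = V - Z - PB" using PB seB by (auto simp: T1_def H_def Z_def)
  have "kstrong r T1 (k - 400 - 4)" unfolding T1_def PB_def
    by (rule kstrong_minus_geodesic[OF p(1) kH H(1)])
  then have kT: "kstrong r T1 (k - 404)" by simp
  have T1V: "T1 \<subseteq> V" "finite T1" using T1 finite_sub[of T1] by auto
  have T1U: "T1 \<subseteq> UA" "T1 \<subseteq> UB" using T1 KU by (auto simp: Z_def)
  \<comment> \<open>\<open>PB\<close> leaves a common neighbour at either end of \<open>KA\<close>\<close>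
  have free: "\<exists>u\<in>N. u \<in> T1" if N: "500 \<le> card N" "N \<subseteq> V" "card (N \<inter> PB) \<le> 2" for N
  proof (rule ccontr)
    assume "\<not> ?thesis"
    then have "N \<subseteq> Z \<union> (N \<inter> PB)" using N(2) by (auto simp: T1)
    then have "card N \<le> card (Z \<union> (N \<inter> PB))" using Z PB(2) by (intro card_mono) auto
    also have "\<dots> \<le> card Z + card (N \<inter> PB)" by (rule card_Un_le)
    finally show False using N Z by linarith
  qed
  have "card ({u. r sA u \<and> r sB u} \<inter> PB) \<le> card ({u. r (p 0) u} \<inter> p ` {..l})"
    unfolding PB_def p(2) by (intro card_mono) auto
  then have "card ({u. r sA u \<and> r sB u} \<inter> PB) \<le> 2" using geodesic_start_out[OF p(1)] by linarith
  from free[OF scard _ this] obtain y1 where y1: "r sA y1" "y1 \<in> T1" using arc_in by blast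
  have "card ({u. r u eA \<and> r u eB} \<inter> PB) \<le> card ({u. r u (p l)} \<inter> p ` {..l})"
    unfolding PB_def p(3) by (intro card_mono) auto
  then have "card ({u. r u eA \<and> r u eB} \<inter> PB) \<le> 2" using geodesic_end_in[OF p(1)] by linarith
  from free[OF ecard _ this] obtain y2 where y2: "r y2 eA" "y2 \<in> T1" using arc_in by blast
  have "strong r T1" using kstrong_strong[OF kT] ks by simp
  from geodesic_exists[OF this y1(2) y2(2)] obtain q m g where
    q: "geodesic r T1 q m g" "q 0 = y1" "q m = y2" by blast
  define PA where "PA = q ` {..m}"
  have PA: "PA \<subseteq> T1" "finite PA" using geodesicD(1)[OF q(1)] by (auto simp: PA_def)
  define T2 where "T2 = T1 - PA"
  have sparse: "1000 * (c - 5) \<le> d" if "(k - a) * (c - 5) \<le> d" "a \<le> 500" for a c d :: nat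
  proof -
    have "1000 * (c - 5) \<le> (k - a) * (c - 5)" using ks that by (intro mult_le_mono1) auto
    from le_trans[OF this that(1)] show ?thesis .
  qed
  let ?FA = "cover r DA" and ?FA' = "cover r\<inverse>\<inverse> DA'" and ?FB = "cover r DB" and ?FB' = "cover r\<inverse>\<inverse> DB'"
  have many: "card N < 2 * card (N \<inter> T2 \<inter> F)"
    if "N \<subseteq> V" "k \<le> card N" "1000 * (card (N \<inter> PB) - 5) \<le> card N"
      "1000 * (card (N \<inter> PA) - 5) \<le> card N" "T1 \<subseteq> U" "U \<subseteq> V" "8 * card (U - F) \<le> card N" for N U F
  proof (rule remainder_large[where ?P1.0 = PB and ?P2.0 = PA and Z = Z and E = "U - F"])
    show "N \<subseteq> N \<inter> T2 \<inter> F \<union> Z \<union> PB \<union> PA \<union> (U - F)"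
      using that(1,5) by (auto simp: T2_def T1)
    show "finite N" "finite (N \<inter> T2 \<inter> F)" "finite (U - F)"
      using finite_sub[OF that(1)] finite_sub[OF that(6)] by simp_all
    show "1000000 \<le> card N" using that(2) ks by linarith
  qed (use Z that in auto)
  have many_in: "card {y. r y x} < 2 * card ({y. r y x} \<inter> T2 \<inter> F)"
    if x: "x \<in> T1" and F: "T1 \<subseteq> U" "U \<subseteq> V" "8 * card (U - F) \<le> card {y. r y x}" for x U F
  proof (rule many[OF _ _ _ _ F])
    show "1000 * (card ({y. r y x} \<inter> PB) - 5) \<le> card {y. r y x}"
      by (rule sparse[OF geodesic_few_in[OF p(1) kH H(1), folded PB_def]]) (use x in \<open>auto simp: T1_def\<close>)
    show "1000 * (card ({y. r y x} \<inter> PA) - 5) \<le> card {y. r y x}"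
      by (rule sparse[OF geodesic_few_in[OF q(1) kT T1V(1), folded PA_def]]) (use x in auto)
  qed (use arc_in din x T1V in auto)
  have many_out: "card {y. r x y} < 2 * card ({y. r x y} \<inter> T2 \<inter> F)"
    if x: "x \<in> T1" and F: "T1 \<subseteq> U" "U \<subseteq> V" "8 * card (U - F) \<le> card {y. r x y}" for x U F
  proof (rule many[OF _ _ _ _ F])
    show "1000 * (card ({y. r x y} \<inter> PB) - 5) \<le> card {y. r x y}"
      by (rule sparse[OF geodesic_few_out[OF p(1) kH H(1), folded PB_def]]) (use x in \<open>auto simp: T1_def\<close>)
    show "1000 * (card ({y. r x y} \<inter> PA) - 5) \<le> card {y. r x y}"
      by (rule sparse[OF geodesic_few_out[OF q(1) kT T1V(1), folded PA_def]]) (use x in auto)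
  qed (use arc_in dout x T1V in auto)
  \<comment> \<open>candidates for attaching \<open>x\<close>\<close>
  define L where "L F x = {y. r y x} \<inter> T2 \<inter> F" for F x
  define L' where "L' F x = {y. r x y} \<inter> T2 \<inter> F" for F x
  have exA: "8 * card (UA - ?FA) \<le> card {y. r y x}" "8 * card (UA - ?FA') \<le> card {y. r x y}"
    and exB: "8 * card (UB - ?FB) \<le> card {y. r y x}" "8 * card (UB - ?FB') \<le> card {y. r x y}"
    if "x \<in> T1" for x using cA(5,6)[of x] cB(5,6)[of x] that T1U by blast+
  have famc: "card (h ` (T1 - F)) \<le> card (U - F)" if "T1 \<subseteq> U" "U \<subseteq> V" for h :: "'a \<Rightarrow> 'a set" and F U
    using card_image_le[of "T1 - F" h] card_mono[of "U - F" "T1 - F"] T1V that finite_sub[of U]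
    by (meson Diff_mono finite_Diff le_trans order_refl)
  have ar: "2 * (a + b) < s" if "d < 2 * s" "a \<le> e" "b \<le> e'" "8 * e \<le> d" "8 * e' \<le> d"
    for a b d e e' s :: nat
  proof -
    have "8 * a \<le> d" "8 * b \<le> d" using that by linarith+
    then show ?thesis using that(1) by presburger
  qed
  have "\<exists>X Y. X \<inter> Y = {} \<and> X \<subseteq> \<Union>(L ?FA ` (T1 - ?FA) \<union> L' ?FA' ` (T1 - ?FA')) \<and>
      Y \<subseteq> \<Union>(L ?FB ` (T1 - ?FB) \<union> L' ?FB' ` (T1 - ?FB')) \<and>
      card Y \<le> card (L ?FB ` (T1 - ?FB)) + card (L' ?FB' ` (T1 - ?FB')) \<and>
      (\<forall>S\<in>L ?FA ` (T1 - ?FA) \<union> L' ?FA' ` (T1 - ?FA'). S \<inter> X \<noteq> {}) \<and>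
      (\<forall>S\<in>L ?FB ` (T1 - ?FB) \<union> L' ?FB' ` (T1 - ?FB'). S \<inter> Y \<noteq> {})"
  proof (rule disjoint_hitting_sets)
    fix S assume "S \<in> L ?FA ` (T1 - ?FA) \<union> L ?FB ` (T1 - ?FB)"
    then obtain x where x: "x \<in> T1" "S = L ?FA x \<or> S = L ?FB x" by blast
    then have "card {y. r y x} < 2 * card S"
      using many_in[OF x(1) T1U(1) sub(1) exA(1)[OF x(1)]] many_in[OF x(1) T1U(2) sub(2) exB(1)[OF x(1)]]
      by (auto simp: L_def)
    then show "2 * (card (L ?FA ` (T1 - ?FA)) + card (L ?FB ` (T1 - ?FB))) < card S"
      by (rule ar[OF _ famc[OF T1U(1) sub(1)] famc[OF T1U(2) sub(2)] exA(1)[OF x(1)] exB(1)[OF x(1)]])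
  next
    fix S assume "S \<in> L' ?FA' ` (T1 - ?FA') \<union> L' ?FB' ` (T1 - ?FB')"
    then obtain x where x: "x \<in> T1" "S = L' ?FA' x \<or> S = L' ?FB' x" by blast
    then have "card {y. r x y} < 2 * card S"
      using many_out[OF x(1) T1U(1) sub(1) exA(2)[OF x(1)]] many_out[OF x(1) T1U(2) sub(2) exB(2)[OF x(1)]]
      by (auto simp: L'_def)
    then show "2 * (card (L' ?FA' ` (T1 - ?FA')) + card (L' ?FB' ` (T1 - ?FB'))) < card S"
      by (rule ar[OF _ famc[OF T1U(1) sub(1)] famc[OF T1U(2) sub(2)] exA(2)[OF x(1)] exB(2)[OF x(1)]])
  qed (use T1V in auto)
  then obtain WA WB where WAB: "WA \<inter> WB = {}"
    and WA: "WA \<subseteq> \<Union>(L ?FA ` (T1 - ?FA) \<union> L' ?FA' ` (T1 - ?FA'))"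
    and WB: "WB \<subseteq> \<Union>(L ?FB ` (T1 - ?FB) \<union> L' ?FB' ` (T1 - ?FB'))"
    and cWB: "card WB \<le> card (L ?FB ` (T1 - ?FB)) + card (L' ?FB' ` (T1 - ?FB'))"
    and hitA: "\<forall>S\<in>L ?FA ` (T1 - ?FA) \<union> L' ?FA' ` (T1 - ?FA'). S \<inter> WA \<noteq> {}"
    and hitB: "\<forall>S\<in>L ?FB ` (T1 - ?FB) \<union> L' ?FB' ` (T1 - ?FB'). S \<inter> WB \<noteq> {}"
    by (elim exE conjE) (rule that)
  have W2: "WA \<subseteq> T2" "WB \<subseteq> T2" using WA WB by (fastforce simp: L_def L'_def)+
  have att: "attached r W F F' x"
    if x: "x \<in> T1" and hit: "\<forall>S\<in>L F ` (T1 - F) \<union> L' F' ` (T1 - F'). S \<inter> W \<noteq> {}" for W F F' x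
  proof -
    have "\<exists>y\<in>W \<inter> F. r y x" if "x \<notin> F"
    proof -
      have "L F x \<inter> W \<noteq> {}" using hit x that by blast
      then show ?thesis by (auto simp: L_def)
    qed
    moreover have "\<exists>y\<in>W \<inter> F'. r x y" if "x \<notin> F'"
    proof -
      have "L' F' x \<inter> W \<noteq> {}" using hit x that by blast
      then show ?thesis by (auto simp: L'_def)
    qed
    ultimately show ?thesis unfolding attached_def by blast
  qed
  have attA: "attached r WA ?FA ?FA' x" if "x \<in> T1" for x by (rule att[OF that hitA])
  have attB: "attached r WB ?FB ?FB' x" if "x \<in> T1" for x by (rule att[OF that hitB])
  define B where "B = KB \<union> PB \<union> WB"
  have VB: "V - B = KA \<union> (T1 - WB)"
  proof -
    have "PB \<inter> KA = {}" using PB(1) seB sub(5) by (auto simp: H_def Z_def)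
    then show ?thesis using sub W2 T1 by (auto simp: B_def Z_def T2_def)
  qed
  have T2T1: "T2 \<subseteq> T1" by (auto simp: T2_def)
  have "B \<subseteq> V" using sub PB H W2 T2T1 T1V by (auto simp: B_def)
  have sB: "strong r B"
  proof (rule core_strong[OF coreB])
    show "KB \<subseteq> B" by (auto simp: B_def)
    have path: "reach r B (p i) (p j)" if "i \<le> j" "j \<le> l" for i j
      by (rule geodesic_reach[OF p(1) _ that]) (auto simp: B_def PB_def)
    show "reach r B sB eB" using path[of 0 l] p(2,3) by simp
    fix x assume "x \<in> B - KB"
    then consider "x \<in> PB" | "x \<in> WB" by (auto simp: B_def)
    then show "attached r B ?FB ?FB' x \<or> (reach r B sB x \<and> reach r B x eB)"
    proof cases
      case 1
      then obtain i where "i \<le> l" "x = p i" by (auto simp: PB_def)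
      then show ?thesis using path[of 0 i] path[of i l] p(2,3) by simp
    next
      case 2
      then have "attached r WB ?FB ?FB' x" using attB W2 T2T1 by blast
      then show ?thesis using attached_mono[of r WB _ _ x B] by (auto simp: B_def)
    qed
  qed
  have PAX: "PA \<subseteq> V - B" using PA W2 by (auto simp: VB T2_def)
  have sA: "strong r (V - B)"
  proof (rule core_strong[OF coreA])
    show "KA \<subseteq> V - B" by (auto simp: VB)
    have "y1 \<in> PA" "y2 \<in> PA" using q by (auto simp: PA_def)
    have "reach r (V - B) sA y1" "reach r (V - B) y2 eA"
      using y1 y2 PAX \<open>y1 \<in> PA\<close> \<open>y2 \<in> PA\<close> seA by (auto simp: VB intro!: reach_step)
    moreover have "reach r (V - B) y1 y2"
      using geodesic_reach[OF q(1), of "V - B" 0 m] PAX q by (simp add: PA_def)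
    ultimately show "reach r (V - B) sA eA" using reach_trans by metis
    fix x assume "x \<in> V - B - KA"
    then have "attached r WA ?FA ?FA' x" using attA by (auto simp: VB)
    moreover have "WA \<subseteq> V - B" using WAB W2 T2T1 by (auto simp: VB)
    ultimately show "attached r (V - B) ?FA ?FA' x \<or> (reach r (V - B) sA x \<and> reach r (V - B) x eA)"
      using attached_mono by metis
  qed
  have nb: "(\<exists>y\<in>B. r y x) \<and> (\<exists>y\<in>B. r x y)" if x: "x \<in> V - B - SA" for x
  proof (cases "x \<in> KA")
    case True
    then show ?thesis using KAnb x by (auto simp: B_def)
  next
    case False
    then have "attached r WB ?FB ?FB' x" using x attB by (auto simp: VB)
    moreover have "DB \<subseteq> B" "DB' \<subseteq> B" "WB \<subseteq> B" using cB(1,2) by (auto simp: B_def)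
    ultimately show ?thesis using x unfolding attached_def cover_def by blast
  qed
  have "2 * card B \<le> card V"
  proof -
    have "card B \<le> card (KB \<union> PB) + card WB" unfolding B_def by (rule card_Un_le)
    moreover have "card (KB \<union> PB) \<le> card KB + card PB" by (rule card_Un_le)
    moreover have "card KB \<le> 400" using Z card_mono[of Z KB] by (auto simp: Z_def)
    moreover have "1000 * (card PB - 2) \<le> card V"
    proof -
      have "1000 * (card PB - 2) \<le> (k - 400) * (card PB - 2)" using ks by (intro mult_le_mono1) auto
      also have "\<dots> \<le> card H" unfolding PB_def by (rule geodesic_length[OF p(1) kH H(2)])
      also have "\<dots> \<le> card V" by (rule card_mono[OF fin H(1)])
      finally show ?thesis .
    qed
    moreover have "8 * card WB \<le> card V"
      using cWB famc[OF T1U(2) sub(2), of "L ?FB" ?FB] famc[OF T1U(2) sub(2), of "L' ?FB'" ?FB']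
        exB[OF y1(2)] in_out_degree_le[of y1] y1(2) T1V by (auto simp: subset_iff)
    ultimately show ?thesis using ks by linarith
  qed
  moreover have "SB \<subseteq> B" "B \<subseteq> V - SA"
    using sub \<open>B \<subseteq> V\<close> VB by (auto simp: B_def)
  ultimately show ?thesis using sB sA nb by blast
qed

lemma strong_extend:
  assumes "strong r B" "B \<subseteq> X" "\<And>x. x \<in> X - B \<Longrightarrow> (\<exists>y\<in>B. r y x) \<and> (\<exists>y\<in>B. r x y)"
  shows "strong r X"
proof -
  have 1: "\<exists>b\<in>B. reach r X x b" and 2: "\<exists>b\<in>B. reach r X b x" if x: "x \<in> X" for x
  proof -
    show "\<exists>b\<in>B. reach r X x b" using x assms(2) assms(3)[of x] reach_step[of x X _ r]
      by (cases "x \<in> B") (auto intro: reach_refl)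
    show "\<exists>b\<in>B. reach r X b x" using x assms(2) assms(3)[of x] reach_step[of _ X x r]
      by (cases "x \<in> B") (auto intro: reach_refl)
  qed
  have 3: "reach r X a b" if "a \<in> B" "b \<in> B" for a b
    using assms(1,2) that reach_mono by (metis strong_def)
  show ?thesis unfolding strong_def
  proof (intro ballI)
    fix x y assume "x \<in> X" "y \<in> X"
    then obtain a b where "a \<in> B" "reach r X x a" "b \<in> B" "reach r X b y" using 1 2 by metis
    then show "reach r X x y" using 3 reach_trans by metis
  qed
qed

text \<open>The smaller of the two cycles is taken outside \<open>B\<close>, where all lengths up to half of the order are
  available. The remaining vertices contain \<open>B\<close>, hence form a strong tournament and have a Hamiltonian
  cycle. If the smaller cycle has to contain \<open>v\<close>, then \<open>v\<close> is kept out of \<open>B\<close>, otherwise it is put into \<open>B\<close>.\<close>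

lemma two_cycles:
  assumes ks: "kstrong r V k" "k < card V" "1000000 \<le> k"
    and v: "v \<in> V" and t: "3 \<le> t" "t + 3 \<le> card V"
  obtains C1 C2 where "cycle_list r C1" "cycle_list r C2" "set C1 \<subseteq> V" "set C2 \<subseteq> V" "set C1 \<inter> set C2 = {}"
    "v \<in> set C1" "length C1 = t" "length C2 = card V - t"
proof -
  have len: "card (set C) = length C" if "cycle_list r C" for C using that by (simp add: cycle_list_def distinct_card)
  have cB: "card (V - B) = card V - card B" if "B \<subseteq> V" for B
    by (rule card_Diff_subset[OF finite_sub[OF that] that])
  have pan: "\<exists>ys. cycle_list r ys \<and> length ys = s \<and> w \<in> set ys \<and> set ys \<subseteq> X"
    if "strong r X" "X \<subseteq> V" "w \<in> X" "3 \<le> s" "s \<le> card X" for X w s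
    by (rule vertex_pancyclic[OF that]) blast
  have t': "3 \<le> card V - t" using t by linarith
  show thesis
  proof (cases "2 * t \<le> card V")
    case True
    obtain B where B: "B \<subseteq> V - {v}" "2 * card B \<le> card V" "strong r B" "strong r (V - B)"
      and nb: "\<And>x. x \<in> V - B - {v} \<Longrightarrow> (\<exists>y\<in>B. r y x) \<and> (\<exists>y\<in>B. r x y)"
      using robust_partition[OF ks, of "{v}" "{}"] v by auto
    have "card (V - B) = card V - card B" using B(1) by (intro cB) blast
    then have tB: "t \<le> card (V - B)" using True B(2) by linarith
    have "v \<in> V - B" using v B(1) by blast
    from pan[OF B(4) Diff_subset this t(1) tB] obtain C1
      where C1: "cycle_list r C1" "length C1 = t" "v \<in> set C1" "set C1 \<subseteq> V - B" by blast
    let ?X = "V - set C1"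
    have "strong r ?X"
    proof (rule strong_extend[OF B(3)])
      show "B \<subseteq> ?X" using B(1) C1(4) by blast
      show "(\<exists>y\<in>B. r y x) \<and> (\<exists>y\<in>B. r x y)" if "x \<in> ?X - B" for x
        using nb[of x] that C1(3) by blast
    qed
    have C1V: "set C1 \<subseteq> V" using C1(4) by blast
    have X: "card ?X = card V - t" using cB[OF C1V] len[OF C1(1)] C1(2) by simp
    then obtain w where "w \<in> ?X" using t' by (metis all_not_in_conv card.empty not_numeral_le_zero)
    from pan[OF \<open>strong r ?X\<close> Diff_subset this t' eq_refl[OF X[symmetric]]] obtain C2
      where "cycle_list r C2" "length C2 = card V - t" "set C2 \<subseteq> ?X" by blast
    then show ?thesis using C1 C1V by (intro that[of C1 C2]) auto
  next
    case False
    obtain B where B: "v \<in> B" "B \<subseteq> V" "2 * card B \<le> card V" "strong r B" "strong r (V - B)"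
      and nb: "\<And>x. x \<in> V - B \<Longrightarrow> (\<exists>y\<in>B. r y x) \<and> (\<exists>y\<in>B. r x y)"
      using robust_partition[OF ks, of "{}" "{v}"] v by auto
    have c: "card V - t \<le> card (V - B)" using False B(3) cB[OF B(2)] by linarith
    then obtain w where "w \<in> V - B" using t' by (metis all_not_in_conv card.empty le_zero_eq not_numeral_le_zero)
    from pan[OF B(5) Diff_subset this t' c] obtain C2
      where C2: "cycle_list r C2" "length C2 = card V - t" "set C2 \<subseteq> V - B" by blast
    let ?X = "V - set C2"
    have "strong r ?X"
    proof (rule strong_extend[OF B(4)])
      show "B \<subseteq> ?X" using B(2) C2(3) by blast
      show "(\<exists>y\<in>B. r y x) \<and> (\<exists>y\<in>B. r x y)" if "x \<in> ?X - B" for x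
        using nb[of x] that by blast
    qed
    have C2V: "set C2 \<subseteq> V" using C2(3) by blast
    have X: "t \<le> card ?X" using cB[OF C2V] len[OF C2(1)] C2(2) t by linarith
    have "v \<in> ?X" using v B(1) C2(3) by blast
    from pan[OF \<open>strong r ?X\<close> Diff_subset this t(1) X] obtain C1
      where "cycle_list r C1" "length C1 = t" "v \<in> set C1" "set C1 \<subseteq> ?X" by blast
    then show ?thesis using C2 C2V by (intro that[of C1 C2]) auto
  qed
qed

end

section \<open>Transfer to digraphs with arc sets\<close>

context tournament
begin

lemma tournament_rel_dominates: "tournament_rel (verts G) (dominates G)"
proof
  show "finite (verts G)" by simp
  show "x \<in> verts G \<and> y \<in> verts G" if "x \<rightarrow> y" for x y
    using adj_in_verts[OF that] by blast
  show "\<not> y \<rightarrow> x" if xy: "x \<rightarrow> y" for x y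
  proof
    assume "y \<rightarrow> x"
    with xy obtain e f where e: "e \<in> arcs G" "tail G e = x" "head G e = y"
      and f: "f \<in> arcs G" "tail G f = y" "head G f = x"
      by (auto simp: arcs_ends_def arc_to_ends_def)
    have "x \<noteq> y" using no_loops[OF e(1)] e(2,3) by simp
    then have "\<exists>!e. e \<in> arcs G \<and> {tail G e, head G e} = {x, y}"
      using e by (intro ex1_arc) auto
    then have "e = f" using e f by (auto simp: insert_commute)
    then show False using e f \<open>x \<noteq> y\<close> by simp
  qed
  show "x \<rightarrow> y \<or> y \<rightarrow> x" if "x \<in> verts G" "y \<in> verts G" "x \<noteq> y" for x y
  proof -
    have "\<exists>!e. e \<in> arcs G \<and> {tail G e, head G e} = {x, y}" by (rule ex1_arc[OF that])
    then obtain e where "e \<in> arcs G" "{tail G e, head G e} = {x, y}" by blast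
    then show ?thesis by (auto simp: arcs_ends_def arc_to_ends_def doubleton_eq_iff)
  qed
qed

lemma strong_of_strongly_connected:
  assumes "strongly_connected (G \<restriction> X)"
  shows "strong (dominates G) X"
  unfolding strong_def
proof (intro ballI)
  fix x y assume "x \<in> X" "y \<in> X"
  then have "(x, y) \<in> rtrancl_on X (arcs_ends (G \<restriction> X))"
    using assms by (auto simp: strongly_connected_def reachable_def)
  then show "reach (dominates G) X x y"
  proof (induction rule: rtrancl_on_induct)
    case (step y z)
    then have "y \<rightarrow> z" by (auto simp: arcs_ends_def arc_to_ends_def)
    then show ?case using step reach_step reach_trans by metis
  qed simp
qed

lemma kstrong_of_strongly_k_connected:
  "strongly_k_connected k G \<Longrightarrow> kstrong (dominates G) (verts G) k"
  unfolding kstrong_def strongly_k_connected_def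
  using strong_of_strongly_connected finite_subset[OF _ finite_verts] by blast

lemma awalk_of_successively:
  assumes "successively (dominates G) (u # xs)" "u \<in> verts G"
  shows "\<exists>p. awalk u p (last (u # xs)) \<and> awalk_verts u p = u # xs"
  using assms
proof (induction xs arbitrary: u)
  case Nil
  then show ?case by (intro exI[of _ "[]"]) (simp add: awalk_Nil_iff)
next
  case (Cons w xs)
  then obtain p where p: "awalk w p (last (w # xs))" "awalk_verts w p = w # xs"
    by (auto dest: adj_in_verts)
  from Cons.prems obtain e where "e \<in> arcs G" "tail G e = u" "head G e = w"
    by (auto simp: arcs_ends_def arc_to_ends_def)
  with p show ?case by (intro exI[of _ "e # p"]) (simp add: awalk_Cons_iff)
qed

lemma cycle_of_cycle_list:
  assumes "cycle_list (dominates G) xs" "set xs \<subseteq> verts G"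
  shows "\<exists>p. cycle p \<and> cycle_verts p = set xs"
proof -
  from assms(1) obtain u ys where xs: "xs = u # ys" by (cases xs) (auto simp: cycle_list_def)
  have "successively (dominates G) (u # (ys @ [u]))"
    using assms(1) by (auto simp: cycle_list_def xs successively_append_iff simp flip: append_Cons)
  then obtain p where p: "awalk u p u" "awalk_verts u p = u # ys @ [u]"
    using awalk_of_successively[of u "ys @ [u]"] assms(2) xs by auto
  then have "p \<noteq> []" by auto
  moreover have "cycle p" unfolding cycle_def
    using p \<open>p \<noteq> []\<close> assms(1) xs by (intro exI[of _ u]) (auto simp: cycle_list_def)
  moreover have "cycle_verts p = set xs"
    using cycle_verts_awalk[OF p(1) \<open>p \<noteq> []\<close>] p(2) xs by auto
  ultimately show ?thesis by blast
qed

end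

theorem corollary1p1:
  fixes T :: "('a, 'b) pre_digraph" and n t :: nat and v :: 'a
  assumes "n \<ge> 6" and "3 \<le> t" and "t \<le> n - 3"
    and "tournament T" and "card (verts T) = n"
    and "strongly_k_connected (4 * 10 ^ 7) T"
    and "v \<in> verts T"
  shows "\<exists>C\<^sub>1 C\<^sub>2. pre_digraph.cycle T C\<^sub>1 \<and> pre_digraph.cycle T C\<^sub>2
    \<and> pre_digraph.cycle_verts T C\<^sub>1 \<inter> pre_digraph.cycle_verts T C\<^sub>2 = {}
    \<and> v \<in> pre_digraph.cycle_verts T C\<^sub>1
    \<and> card (pre_digraph.cycle_verts T C\<^sub>1) = t
    \<and> card (pre_digraph.cycle_verts T C\<^sub>2) = n - t"
proof -
  interpret T: tournament T by (rule assms(4))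
  interpret tournament_rel "verts T" "dominates T" by (rule T.tournament_rel_dominates)
  have "4 * 10 ^ 7 < card (verts T)" using assms(6) by (simp add: strongly_k_connected_def)
  moreover have "1000000 \<le> (4 * 10 ^ 7 :: nat)" "t + 3 \<le> card (verts T)"
    using assms(1,3,5) by simp_all
  ultimately obtain xs ys where xs: "cycle_list (dominates T) xs" "set xs \<subseteq> verts T" "length xs = t" "v \<in> set xs"
    and ys: "cycle_list (dominates T) ys" "set ys \<subseteq> verts T" "length ys = card (verts T) - t"
    and disj: "set xs \<inter> set ys = {}"
    using T.kstrong_of_strongly_k_connected[OF assms(6)] assms(2,7)
    by (elim two_cycles)
  obtain C D where "T.cycle C" "T.cycle_verts C = set xs" "T.cycle D" "T.cycle_verts D = set ys"
    using T.cycle_of_cycle_list[OF xs(1,2)] T.cycle_of_cycle_list[OF ys(1,2)] by blast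
  moreover have "card (set xs) = t" "card (set ys) = n - t"
    using xs(1,3) ys(1,3) assms(5) by (auto simp: cycle_list_def distinct_card)
  ultimately show ?thesis using disj xs(4) by (intro exI[of _ C] exI[of _ D]) simp
qed

end
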